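(* Let $\Phi$ be a Schur channel on $\mathrm{L}(\mathcal{H}_d)$ such that $K(\Phi)\cap \mathrm{U}(\mathcal{H}_d)=\emptyset$. Then for all integers $n\ge 1$, $$D\big(\Phi^{\otimes n},\ \mathrm{Conv}(\mathbb{U}(\mathcal{H}_d^{\otimes n}))\big)\ \ge\ C_\Phi\ >\ 0,$$ where $$C_\Phi=\min_{L\in K(\Phi)}\frac{\mathrm{Tr}\,\big((|L|-I_d)^2\big)}{d}.$$
   Context: $\mathcal{H}_d$ denotes a $d$-dimensional complex Hilbert space with a fixed orthonormal basis; $\mathrm{L}(\mathcal{H})$ is the space of linear operators on $\mathcal{H}$; $\mathrm{U}(\mathcal{H})$ is the set of unitary operators on $\mathcal{H}$; $|L|=\sqrt{L^\dagger L}$; $I_d$ is the identity on $\mathcal{H}_d$. A Schur channel on $\mathrm{L}(\mathcal{H}_d)$ is a map $\Phi_S(X)=S\circ X$ (entrywise product in the fixed basis), where $S$ is a $d\times d$ positive semidefinite matrix with all diagonal entries equal to $1$; it is completely positive and trace preserving. For a completely positive trace-preserving map $\Phi(X)=\sum_k E_kXE_k^\dagger$ (Kraus representation), the Kraus operator space is $K(\Phi)=\mathrm{span}_{\mathbb{C}}\{E_k\}$ (independent of the representation). $\mathbb{U}(\mathcal{H})$ is the set of unitary channels $X\mapsto UXU^\dagger$, $U\in\mathrm{U}(\mathcal{H})$, and $\mathrm{Conv}$ denotes convex hull. For a linear map $\Phi$ on $\mathrm{L}(\mathcal{H})$, $\|\Phi\|_1=\sup_{\|X\|_1\le 1}\|\Phi(X)\|_1$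 with $\|X\|_1=\mathrm{Tr}|X|$, and the diamond norm is $\|\Phi\|_\diamond=\sup_{n\ge1}\|\Phi\otimes \mathrm{id}_{\mathrm{L}(\mathbb{C}^n)}\|_1$. $D(\Phi,\Psi)=\|\Phi-\Psi\|_\diamond$, and $D(\Phi,\mathcal{S})=\inf_{\Psi\in\mathcal{S}}D(\Phi,\Psi)$ for a set $\mathcal{S}$ of channels. *)

theory Defs
  imports
    Complex_Main
    "HOL-Library.Extended_Real"
    "Jordan_Normal_Form.Schur_Decomposition"
    "Jordan_Normal_Form.VS_Connect"
begin

text \<open>
  Operators on the \<open>d\<close>-dimensional space with its fixed orthonormal basis are the matrices in
  \<open>carrier_mat d d\<close>. A linear map on operators is a function \<open>complex mat \<Rightarrow> complex mat\<close>; only its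
  values on the relevant carrier are ever used, and the dimension is passed explicitly.
\<close>

definition tr :: "complex mat \<Rightarrow> complex" where
  "tr A = (\<Sum>i<dim_row A. A $$ (i, i))"

definition mat_sum :: "nat \<Rightarrow> ('i \<Rightarrow> complex mat) \<Rightarrow> 'i set \<Rightarrow> complex mat" where
  "mat_sum n f I = mat n n (\<lambda>(i, j). \<Sum>k\<in>I. f k $$ (i, j))"

text \<open>Over the complex numbers \<open>0 \<le> z\<close> says that \<open>z\<close> is real and nonnegative.\<close>

definition psd :: "nat \<Rightarrow> complex mat \<Rightarrow> bool" where
  "psd n A \<longleftrightarrow> A \<in> carrier_mat n n \<and> (\<forall>v\<in>carrier_vec n. 0 \<le> (A *\<^sub>v v) \<bullet>c v)"

definition unitaries :: "nat \<Rightarrow> complex mat set" where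
  "unitaries n = {U \<in> carrier_mat n n. mat_adjoint U * U = 1\<^sub>m n \<and> U * mat_adjoint U = 1\<^sub>m n}"

text \<open>\<open>op_abs L\<close> is the unique positive semidefinite square root of \<open>L\<^sup>\<dagger> L\<close>.\<close>

definition op_abs :: "complex mat \<Rightarrow> complex mat" where
  "op_abs L = (THE P. psd (dim_col L) P \<and> P * P = mat_adjoint L * L)"

definition trace_norm :: "complex mat \<Rightarrow> real" where
  "trace_norm X = Re (tr (op_abs X))"

text \<open>The basis vector \<open>e\<^sub>i \<otimes> e\<^sub>k\<close> of a tensor product is numbered \<open>i * m + k\<close>, where \<open>m\<close> is the
  dimension of the second factor.\<close>

definition kron :: "complex mat \<Rightarrow> complex mat \<Rightarrow> complex mat" where
  "kron A B = mat (dim_row A * dim_row B) (dim_col A * dim_col B)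
     (\<lambda>(i, j). A $$ (i div dim_row B, j div dim_col B) * B $$ (i mod dim_row B, j mod dim_col B))"

definition matrix_unit :: "nat \<Rightarrow> nat \<Rightarrow> nat \<Rightarrow> complex mat" where
  "matrix_unit n a b = mat n n (\<lambda>(i, j). if i = a \<and> j = b then 1 else 0)"

text \<open>The linear map with \<open>A \<otimes> B \<mapsto> \<Phi> A \<otimes> \<Psi> B\<close>, for linear maps \<open>\<Phi>\<close> and \<open>\<Psi>\<close> on operators of
  dimensions \<open>d\<close> and \<open>m\<close>: expand the argument in the basis of tensor products of matrix units.\<close>

definition tensor_map ::
  "nat \<Rightarrow> (complex mat \<Rightarrow> complex mat) \<Rightarrow> nat \<Rightarrow> (complex mat \<Rightarrow> complex mat)
     \<Rightarrow> complex mat \<Rightarrow> complex mat" where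
  "tensor_map d \<Phi> m \<Psi> X =
     mat_sum (d * m)
       (\<lambda>(a, b, c, e). X $$ (a * m + c, b * m + e) \<cdot>\<^sub>m
          kron (\<Phi> (matrix_unit d a b)) (\<Psi> (matrix_unit m c e)))
       ({..<d} \<times> {..<d} \<times> {..<m} \<times> {..<m})"

text \<open>The \<open>n\<close>-fold tensor power, acting on operators of dimension \<open>d ^ n\<close>.\<close>

primrec tensor_power_map ::
  "nat \<Rightarrow> (complex mat \<Rightarrow> complex mat) \<Rightarrow> nat \<Rightarrow> complex mat \<Rightarrow> complex mat" where
  "tensor_power_map d \<Phi> 0 = (\<lambda>X. X)"
| "tensor_power_map d \<Phi> (Suc n) = tensor_map d \<Phi> (d ^ n) (tensor_power_map d \<Phi> n)"

definition schur_product :: "complex mat \<Rightarrow> complex mat \<Rightarrow> complex mat" where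
  "schur_product S X = mat (dim_row X) (dim_col X) (\<lambda>(i, j). S $$ (i, j) * X $$ (i, j))"

definition schur_channel :: "nat \<Rightarrow> (complex mat \<Rightarrow> complex mat) \<Rightarrow> bool" where
  "schur_channel d \<Phi> \<longleftrightarrow>
     (\<exists>S. psd d S \<and> (\<forall>i<d. S $$ (i, i) = 1) \<and> (\<forall>X\<in>carrier_mat d d. \<Phi> X = schur_product S X))"

definition kraus_rep :: "nat \<Rightarrow> complex mat list \<Rightarrow> (complex mat \<Rightarrow> complex mat) \<Rightarrow> bool" where
  "kraus_rep d Es \<Phi> \<longleftrightarrow> set Es \<subseteq> carrier_mat d d \<and>
     (\<forall>X\<in>carrier_mat d d. \<Phi> X = mat_sum d (\<lambda>k. Es ! k * X * mat_adjoint (Es ! k)) {..<length Es})"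

text \<open>The span does not depend on the Kraus representation, so any one may be chosen.\<close>

definition kraus_space :: "nat \<Rightarrow> (complex mat \<Rightarrow> complex mat) \<Rightarrow> complex mat set" where
  "kraus_space d \<Phi> =
     LinearCombinations.module.span class_ring (module_mat TYPE(complex) d d)
       (set (SOME Es. kraus_rep d Es \<Phi>))"

definition unitary_channels :: "nat \<Rightarrow> (complex mat \<Rightarrow> complex mat) set" where
  "unitary_channels n = (\<lambda>U X. U * X * mat_adjoint U) ` unitaries n"

text \<open>Convex hull of a set of maps on operators of dimension \<open>n\<close>.\<close>

definition conv_maps ::
  "nat \<Rightarrow> (complex mat \<Rightarrow> complex mat) set \<Rightarrow> (complex mat \<Rightarrow> complex mat) set" where
  "conv_maps n F =
     {\<lambda>X. mat_sum n (\<lambda>k. complex_of_real (p k) \<cdot>\<^sub>m \<Psi> k X) {..<r} | (r :: nat) p \<Psi>.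
        (\<forall>k<r. 0 \<le> p k \<and> \<Psi> k \<in> F) \<and> (\<Sum>k<r. p k) = 1}"

text \<open>Norms and distances of maps are extended reals, so that the suprema and infima are
  unconditionally meaningful; they are finite for linear maps (and nonempty sets of them).\<close>

definition map_norm1 :: "nat \<Rightarrow> (complex mat \<Rightarrow> complex mat) \<Rightarrow> ereal" where
  "map_norm1 n \<Phi> = (SUP X\<in>{X \<in> carrier_mat n n. trace_norm X \<le> 1}. ereal (trace_norm (\<Phi> X)))"

definition diamond_norm :: "nat \<Rightarrow> (complex mat \<Rightarrow> complex mat) \<Rightarrow> ereal" where
  "diamond_norm d \<Phi> = (SUP m\<in>{1..}. map_norm1 (d * m) (tensor_map d \<Phi> m (\<lambda>Y. Y)))"

definition diamond_dist ::
  "nat \<Rightarrow> (complex mat \<Rightarrow> complex mat) \<Rightarrow> (complex mat \<Rightarrow> complex mat) \<Rightarrow> ereal" where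
  "diamond_dist d \<Phi> \<Psi> = diamond_norm d (\<lambda>X. \<Phi> X - \<Psi> X)"

definition diamond_dist_set ::
  "nat \<Rightarrow> (complex mat \<Rightarrow> complex mat) \<Rightarrow> (complex mat \<Rightarrow> complex mat) set \<Rightarrow> ereal" where
  "diamond_dist_set d \<Phi> F = (INF \<Psi>\<in>F. diamond_dist d \<Phi> \<Psi>)"

definition unitarity_defect :: "nat \<Rightarrow> complex mat \<Rightarrow> real" where
  "unitarity_defect d L = Re (tr ((op_abs L - 1\<^sub>m d) ^\<^sub>m 2)) / real d"

text \<open>Written as an infimum; that it is attained has to be stated separately.\<close>

definition C_const :: "nat \<Rightarrow> (complex mat \<Rightarrow> complex mat) \<Rightarrow> real" where
  "C_const d \<Phi> = (INF L\<in>kraus_space d \<Phi>. unitarity_defect d L)"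

end

theory Submission
  imports Defs
begin

text \<open>
  The test input is the maximally entangled state on two copies of the \<open>d\<^sup>n\<close>-dimensional space. The Kraus
  space of a Schur channel with matrix \<open>S\<close> consists of the diagonal operators with diagonal in the range
  of \<open>S\<close>; let \<open>P\<close> be the orthogonal projection onto that range. On the vectors \<open>e\<^sub>i \<otimes> e\<^sub>i\<close> take the projection
  \<open>P \<otimes> I\<close>, with \<open>P\<close> acting on the first of the \<open>n\<close> factors only. The output of \<open>\<Phi>\<^sup>\<otimes>\<^sup>n\<close> has overlap \<open>1\<close> with it.
  The output of a unitary channel \<open>U\<close> has as overlap the average over the slices \<open>u\<close> of the diagonal of \<open>U\<close> of
  \<open>\<parallel>P u\<parallel>\<^sup>2 / d\<close>. The entries of \<open>u\<close> have modulus at most \<open>1\<close>, so \<open>w = P u\<close> satisfies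
  \<open>\<parallel>w\<parallel>\<^sup>2 = \<langle>w, u\<rangle> \<le> \<Sum>\<bar>w\<^sub>i\<bar>\<close>, and \<open>\<Sum>(\<bar>w\<^sub>i\<bar> - 1)\<^sup>2 \<ge> d C\<close> gives \<open>\<parallel>w\<parallel>\<^sup>2 \<le> d (1 - C)\<close>. So the overlaps differ by at
  least \<open>C\<close>, and the trace norm of the difference of the outputs is no smaller.
\<close>

section \<open>Vectors and forms with coordinates\<close>

text \<open>Vectors are functions on \<open>nat\<close> of which only the values below
  \<open>n\<close> count, so no carrier conditions arise. The form is linear in the first argument
  and conjugate-linear in the second.\<close>

definition ip :: "nat \<Rightarrow> (nat \<Rightarrow> complex) \<Rightarrow> (nat \<Rightarrow> complex) \<Rightarrow> complex" where
  "ip n u v = (\<Sum>i<n. u i * cnj (v i))"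

definition app :: "nat \<Rightarrow> (nat \<Rightarrow> nat \<Rightarrow> complex) \<Rightarrow> (nat \<Rightarrow> complex) \<Rightarrow> nat \<Rightarrow> complex" where
  "app n a v = (\<lambda>i. \<Sum>j<n. a i j * v j)"

definition herm :: "nat \<Rightarrow> (nat \<Rightarrow> nat \<Rightarrow> complex) \<Rightarrow> bool" where
  "herm n a \<longleftrightarrow> (\<forall>i<n. \<forall>j<n. a j i = cnj (a i j))"

lemma ip_cong:
  "(\<And>i. i < n \<Longrightarrow> u i = u' i) \<Longrightarrow> (\<And>i. i < n \<Longrightarrow> v i = v' i) \<Longrightarrow> ip n u v = ip n u' v'"
  by (simp add: ip_def)

lemma app_cong: "(\<And>j. j < n \<Longrightarrow> v j = v' j) \<Longrightarrow> app n a v = app n a v'"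
  by (simp add: app_def)

lemma ip_add_left: "ip n (\<lambda>i. u i + u' i) v = ip n u v + ip n u' v"
  by (simp add: ip_def algebra_simps sum.distrib)

lemma ip_diff_left: "ip n (\<lambda>i. u i - u' i) v = ip n u v - ip n u' v"
  by (simp add: ip_def algebra_simps sum_subtractf)

lemma ip_scale_left: "ip n (\<lambda>i. c * u i) v = c * ip n u v"
  by (simp add: ip_def sum_distrib_left algebra_simps)

lemma ip_sum_left: "ip n (\<lambda>i. \<Sum>k\<in>K. f k i) v = (\<Sum>k\<in>K. ip n (f k) v)"
  unfolding ip_def sum_distrib_right by (rule sum.swap)

lemma ip_cnj: "ip n v u = cnj (ip n u v)"
  by (simp add: ip_def mult.commute)

lemma ip_add_right: "ip n v (\<lambda>i. u i + u' i) = ip n v u + ip n v u'"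
  by (simp add: ip_def algebra_simps sum.distrib)

lemma ip_diff_right: "ip n v (\<lambda>i. u i - u' i) = ip n v u - ip n v u'"
  by (simp add: ip_def algebra_simps sum_subtractf)

lemma ip_scale_right: "ip n v (\<lambda>i. c * u i) = cnj c * ip n v u"
  by (simp add: ip_def sum_distrib_left algebra_simps)

lemma ip_sum_right: "ip n v (\<lambda>i. \<Sum>k\<in>K. f k i) = (\<Sum>k\<in>K. ip n v (f k))"
  unfolding ip_def cnj_sum sum_distrib_left by (rule sum.swap)

lemmas ip_linear = ip_add_left ip_diff_left ip_scale_left ip_sum_left
  ip_add_right ip_diff_right ip_scale_right ip_sum_right

lemma ip_self: "ip n v v = complex_of_real (\<Sum>i<n. (cmod (v i))\<^sup>2)"
  unfolding ip_def of_real_sum complex_norm_square ..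

lemma ip_self_eq_0: "ip n v v = 0 \<Longrightarrow> i < n \<Longrightarrow> v i = 0"
  unfolding ip_self of_real_eq_0_iff by (subst (asm) sum_nonneg_eq_0_iff) auto

lemma ip_self_real: "ip n v v = complex_of_real (Re (ip n v v))"
  by (simp add: ip_self)

lemma ip_self_nonneg: "0 \<le> Re (ip n v v)"
  by (simp add: ip_self sum_nonneg)

lemma app_add: "app n a (\<lambda>i. u i + v i) = (\<lambda>i. app n a u i + app n a v i)"
  by (simp add: app_def algebra_simps sum.distrib)

lemma app_diff: "app n a (\<lambda>i. u i - v i) = (\<lambda>i. app n a u i - app n a v i)"
  by (simp add: app_def algebra_simps sum_subtractf)

lemma app_scale: "app n a (\<lambda>i. c * v i) = (\<lambda>i. c * app n a v i)"
  by (simp add: app_def algebra_simps sum_distrib_left)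

lemma app_sum: "app n a (\<lambda>i. \<Sum>k\<in>K. f k i) = (\<lambda>i. \<Sum>k\<in>K. app n a (f k) i)"
  unfolding app_def sum_distrib_left by (intro ext sum.swap)

lemma herm_ip_app:
  assumes "herm n a"
  shows "ip n (app n a u) v = ip n u (app n a v)"
proof -
  have "ip n (app n a u) v = (\<Sum>i<n. \<Sum>j<n. a i j * u j * cnj (v i))"
    by (simp add: ip_def app_def sum_distrib_right)
  also have "\<dots> = (\<Sum>j<n. \<Sum>i<n. a i j * u j * cnj (v i))"
    by (rule sum.swap)
  also have "\<dots> = (\<Sum>j<n. \<Sum>i<n. u j * (cnj (a j i) * cnj (v i)))"
  proof (intro sum.cong refl)
    fix i j assume "j \<in> {..<n}" "i \<in> {..<n}"
    then have "a i j = cnj (a j i)" using assms unfolding herm_def by blast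
    then show "a i j * u j * cnj (v i) = u j * (cnj (a j i) * cnj (v i))"
      by simp
  qed
  also have "\<dots> = ip n u (app n a v)"
    by (simp add: ip_def app_def sum_distrib_left)
  finally show ?thesis .
qed

text \<open>Polarisation: the form is real at \<open>u + v\<close> and at
  \<open>u + \<i> * v\<close>, which gives the imaginary and the real part of the symmetry; unit
  vectors then extract the entries.\<close>

lemma psd_form_herm:
  assumes "\<And>v. 0 \<le> ip n (app n a v) v"
  shows "herm n a"
proof -
  have real: "Im (ip n (app n a v) v) = 0" for v
    using assms[of v] by (simp add: less_eq_complex_def)
  have sym: "ip n (app n a v) u = cnj (ip n (app n a u) v)" for u v
  proof -
    have "Im (ip n (app n a u) v + ip n (app n a v) u) = 0"
      using real[of "\<lambda>i. u i + v i"] real[of u] real[of v] by (simp add: app_add ip_linear)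
    moreover have "Im (- (\<i> * ip n (app n a u) v) + \<i> * ip n (app n a v) u) = 0"
      using real[of "\<lambda>i. u i + \<i> * v i"] real[of u] real[of v]
      by (simp add: app_add app_scale ip_linear)
    ultimately show ?thesis by (simp add: complex_eq_iff)
  qed
  have "ip n (app n a (\<lambda>k. if k = j then 1 else 0)) (\<lambda>k. if k = i then 1 else 0) = a i j"
    if "i < n" "j < n" for i j
    using that by (simp add: ip_def app_def if_distrib cong: if_cong)
  then show ?thesis unfolding herm_def using sym by metis
qed

section \<open>Compactness and attained minima in coordinates\<close>

lemma bolzano_weierstrass_coords:
  fixes s :: "nat \<Rightarrow> nat \<Rightarrow> complex"
  assumes "\<And>m i. i < n \<Longrightarrow> cmod (s m i) \<le> B"
  shows "\<exists>r v. strict_mono (r :: nat \<Rightarrow> nat) \<and> (\<forall>i<n. (\<lambda>m. s (r m) i) \<longlonglongrightarrow> v i)"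
  using assms
proof (induction n)
  case 0
  show ?case by (intro exI[of _ id]) (auto simp: strict_mono_def)
next
  case (Suc n)
  then obtain r v where r: "strict_mono r" "\<And>i. i < n \<Longrightarrow> (\<lambda>m. s (r m) i) \<longlonglongrightarrow> v i"
    by (metis less_SucI)
  have "\<forall>m. cmod (s (r m) n) \<le> B" using Suc.prems by simp
  \<comment> \<open>Thinning out the subsequence once more for coordinate \<open>n\<close> keeps the
    limits of the earlier coordinates.\<close>
  then obtain f :: "nat \<Rightarrow> nat" and z where f: "strict_mono f"
    "\<forall>e>0. \<exists>N. \<forall>m\<ge>N. cmod (s (r (f m)) n - z) < e"
    using Bolzano_Weierstrass_complex_disc[of "\<lambda>m. s (r m) n" B] by blast
  then have z: "(\<lambda>m. s (r (f m)) n) \<longlonglongrightarrow> z"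
    by (simp add: LIMSEQ_iff)
  have "(\<lambda>m. s (r (f m)) i) \<longlonglongrightarrow> (v(n := z)) i" if "i < Suc n" for i
  proof (cases "i = n")
    case False
    then have "(\<lambda>m. s (r m) i) \<longlonglongrightarrow> v i" using r that by simp
    then have "((\<lambda>m. s (r m) i) \<circ> f) \<longlonglongrightarrow> v i" using f(1) by (rule LIMSEQ_subseq_LIMSEQ)
    then show ?thesis using False by (simp add: o_def)
  qed (use z in simp)
  moreover have "strict_mono (r \<circ> f)" using r(1) f(1) by (rule strict_mono_o)
  ultimately show ?case by (intro exI[of _ "r \<circ> f"] exI[of _ "v(n := z)"]) (simp add: o_def)
qed

text \<open>The direct method: a minimising sequence has a subsequence that converges in every
  coordinate; its limit stays in \<open>K\<close> and carries the infimum. Boundedness of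
  \<open>f\<close> below is obtained along the way.\<close>

lemma attains_min_coords:
  fixes f :: "(nat \<Rightarrow> complex) \<Rightarrow> real"
  assumes ne: "K \<noteq> {}"
    and bd: "\<And>v i. v \<in> K \<Longrightarrow> i < n \<Longrightarrow> cmod (v i) \<le> B"
    and closed: "\<And>s v. (\<And>m. s m \<in> K) \<Longrightarrow> (\<And>i. i < n \<Longrightarrow> (\<lambda>m. s m i) \<longlonglongrightarrow> v i) \<Longrightarrow> v \<in> K"
    and cont: "\<And>s v. (\<And>i. i < n \<Longrightarrow> (\<lambda>m. s m i) \<longlonglongrightarrow> v i) \<Longrightarrow> (\<lambda>m. f (s m)) \<longlonglongrightarrow> f v"
  shows "\<exists>v\<in>K. \<forall>w\<in>K. f v \<le> f w"
proof -
  \<comment> \<open>The thresholds push \<open>f (s m)\<close> towards the infimum, or towards minus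
    infinity if \<open>f\<close> is unbounded below on \<open>K\<close>; the second case is refuted
    later because \<open>f\<close> converges along the subsequence.\<close>
  define b where "b m = (if bdd_below (f ` K) then Inf (f ` K) + 1 / real (Suc m) else - real m)" for m
  have "\<exists>v\<in>K. f v < b m" for m
  proof (cases "bdd_below (f ` K)")
    case True
    have "Inf (f ` K) < b m" using True by (simp add: b_def)
    then show ?thesis using cInf_lessD[of "f ` K" "b m"] ne by auto
  next
    case False
    then show ?thesis unfolding b_def bdd_below_def by (auto simp: not_le)
  qed
  then obtain s where s: "\<And>m. s m \<in> K" "\<And>m. f (s m) < b m" by metis
  obtain r v where r: "strict_mono (r :: nat \<Rightarrow> nat)" "\<And>i. i < n \<Longrightarrow> (\<lambda>m. s (r m) i) \<longlonglongrightarrow> v i"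
    using bolzano_weierstrass_coords[of n s B] bd s(1) by metis
  have v: "v \<in> K" using closed[of "\<lambda>m. s (r m)"] s(1) r(2) by simp
  have lim: "(\<lambda>m. f (s (r m))) \<longlonglongrightarrow> f v" using cont[of "\<lambda>m. s (r m)"] r(2) by simp
  have bdd: "bdd_below (f ` K)"
  proof (rule ccontr)
    assume nb: "\<not> bdd_below (f ` K)"
    have "f v \<le> - real N" for N
    proof (rule LIMSEQ_le_const2[OF lim])
      have "f (s (r m)) \<le> - real N" if "N \<le> m" for m
        using s(2)[of "r m"] nb seq_suble[OF r(1), of m] that by (simp add: b_def)
      then show "\<exists>N'. \<forall>m\<ge>N'. f (s (r m)) \<le> - real N" by blast
    qed
    then have "real N \<le> - f v" for N by (metis minus_le_iff minus_minus)
    then show False using reals_Archimedean2[of "- f v"] by (meson not_le)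
  qed
  have "(\<lambda>m. Inf (f ` K) + 1 / real (Suc m)) \<longlonglongrightarrow> Inf (f ` K) + 0"
    by (intro tendsto_add tendsto_const LIMSEQ_Suc[OF lim_1_over_n])
  then have "(\<lambda>m. Inf (f ` K) + 1 / real (Suc (r m))) \<longlonglongrightarrow> Inf (f ` K)"
    using LIMSEQ_subseq_LIMSEQ[OF _ r(1)] by (fastforce simp: o_def)
  moreover have "f (s (r m)) \<le> Inf (f ` K) + 1 / real (Suc (r m))" for m
    using s(2)[of "r m"] bdd by (simp add: b_def)
  ultimately have "f v \<le> Inf (f ` K)" using LIMSEQ_le[OF lim] by blast
  then have "f v \<le> f w" if "w \<in> K" for w
    using cInf_lower[of "f w" "f ` K"] that bdd by force
  with v show ?thesis by blast
qed

section \<open>The spectral theorem for Hermitian matrices\<close>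

definition orthonormal :: "nat \<Rightarrow> nat \<Rightarrow> (nat \<Rightarrow> nat \<Rightarrow> complex) \<Rightarrow> bool" where
  "orthonormal n m V \<longleftrightarrow> (\<forall>k<m. \<forall>l<m. ip n (V k) (V l) = (if k = l then 1 else 0))"

text \<open>Orthogonal projection of the \<open>j\<close>-th unit vector onto the complement of the span of \<open>V\<close>.\<close>

definition unit_residual :: "nat \<Rightarrow> (nat \<Rightarrow> nat \<Rightarrow> complex) \<Rightarrow> nat \<Rightarrow> nat \<Rightarrow> complex" where
  "unit_residual m V j = (\<lambda>i. (if i = j then 1 else 0) - (\<Sum>k<m. cnj (V k j) * V k i))"

lemma ip_unit: "j < n \<Longrightarrow> ip n v (\<lambda>i. if i = j then 1 else 0) = v j"
  "j < n \<Longrightarrow> ip n (\<lambda>i. if i = j then 1 else 0) v = cnj (v j)"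
  by (simp_all add: ip_def if_distrib if_distribR cong: if_cong)

lemma unit_residual_orthogonal:
  assumes "orthonormal n m V" "j < n" "l < m"
  shows "ip n (unit_residual m V j) (V l) = 0"
proof -
  have "(\<Sum>k<m. cnj (V k j) * ip n (V k) (V l)) = (\<Sum>k<m. if k = l then cnj (V k j) else 0)"
    using assms by (intro sum.cong refl) (auto simp: orthonormal_def)
  then show ?thesis
    using assms by (simp add: unit_residual_def ip_linear ip_unit)
qed

text \<open>The residual is orthogonal to all \<open>V k\<close>, so pairing it with itself leaves
  only its pairing with the unit vector, that is, its own entry \<open>j\<close>.\<close>

lemma unit_residual_norm:
  assumes "orthonormal n m V" "j < n"
  shows "ip n (unit_residual m V j) (unit_residual m V j) = 1 - (\<Sum>k<m. V k j * cnj (V k j))"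
proof -
  have "ip n (unit_residual m V j) (unit_residual m V j)
      = ip n (unit_residual m V j)
          (\<lambda>i. (if i = j then 1 else 0) - (\<Sum>k<m. cnj (V k j) * V k i))"
    by (subst (2) unit_residual_def) simp
  also have "\<dots> = unit_residual m V j j - (\<Sum>k<m. V k j * ip n (unit_residual m V j) (V k))"
    using assms(2) by (simp add: ip_linear ip_unit)
  also have "\<dots> = unit_residual m V j j"
    using unit_residual_orthogonal[OF assms] by simp
  finally show ?thesis by (simp add: unit_residual_def mult.commute)
qed

text \<open>This is the trace of the projection onto the complement of \<open>V\<close>. Nonzero for
  \<open>m < n\<close>, it yields a further orthogonal vector; zero for \<open>m = n\<close>, it
  yields completeness.\<close>

lemma sum_unit_residual_norm:
  assumes "orthonormal n m V"
  shows "(\<Sum>j<n. ip n (unit_residual m V j) (unit_residual m V j)) = of_nat n - of_nat m"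
proof -
  have "(\<Sum>j<n. \<Sum>k<m. V k j * cnj (V k j)) = (\<Sum>k<m. ip n (V k) (V k))"
    unfolding ip_def by (rule sum.swap)
  also have "\<dots> = of_nat m" using assms by (simp add: orthonormal_def)
  finally show ?thesis
    by (simp add: unit_residual_norm[OF assms] sum_subtractf)
qed

lemma ex_unit_orthogonal:
  assumes "orthonormal n m V" "m < n"
  shows "\<exists>v. ip n v v = 1 \<and> (\<forall>l<m. ip n v (V l) = 0)"
proof -
  have "(\<Sum>j<n. ip n (unit_residual m V j) (unit_residual m V j)) \<noteq> 0"
    using assms(2) by (simp add: sum_unit_residual_norm[OF assms(1)])
  then obtain j where j: "j < n" "ip n (unit_residual m V j) (unit_residual m V j) \<noteq> 0"
    by (metis (no_types, lifting) lessThan_iff sum.neutral)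
  define u where "u = unit_residual m V j"
  define c where "c = Re (ip n u u)"
  have c: "ip n u u = of_real c" "c > 0"
    using j ip_self_real[of n u] ip_self_nonneg[of n u] by (auto simp: u_def c_def less_le)
  have "ip n (\<lambda>i. of_real (1 / sqrt c) * u i) (\<lambda>i. of_real (1 / sqrt c) * u i) = 1"
    using c by (simp only: ip_linear complex_cnj_complex_of_real of_real_mult[symmetric])
      (simp add: field_simps)
  moreover have "\<forall>l<m. ip n (\<lambda>i. of_real (1 / sqrt c) * u i) (V l) = 0"
    using unit_residual_orthogonal[OF assms(1) j(1)]
    by (simp only: ip_linear u_def mult_zero_right) simp
  ultimately show ?thesis by blast
qed

text \<open>With \<open>n\<close> vectors the squared residual norms are nonnegative and sum to
  \<open>0\<close>, so all residuals vanish; entry \<open>i\<close> of residual \<open>j\<close> is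
  the claim.\<close>

lemma orthonormal_complete:
  assumes "orthonormal n n V" "i < n" "j < n"
  shows "(\<Sum>k<n. V k i * cnj (V k j)) = (if i = j then 1 else 0)"
proof -
  have "(\<Sum>j<n. Re (ip n (unit_residual n V j) (unit_residual n V j))) = 0"
    using sum_unit_residual_norm[OF assms(1)] by (simp flip: Re_sum)
  then have "Re (ip n (unit_residual n V j) (unit_residual n V j)) = 0"
    using assms(3) ip_self_nonneg by (subst (asm) sum_nonneg_eq_0_iff) auto
  then have "unit_residual n V j i = 0"
    using assms(2) ip_self_eq_0 ip_self_real by (metis of_real_0)
  then show ?thesis by (simp add: unit_residual_def mult.commute)
qed

lemma orthonormal_expand:
  assumes "orthonormal n n V" "i < n"
  shows "v i = (\<Sum>k<n. ip n v (V k) * V k i)"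
proof -
  have "(\<Sum>k<n. ip n v (V k) * V k i) = (\<Sum>k<n. \<Sum>j<n. v j * (V k i * cnj (V k j)))"
    by (simp add: ip_def sum_distrib_right sum_distrib_left ac_simps)
  also have "\<dots> = (\<Sum>j<n. v j * (\<Sum>k<n. V k i * cnj (V k j)))"
    unfolding sum_distrib_left by (rule sum.swap)
  also have "\<dots> = (\<Sum>j<n. if j = i then v j else 0)"
    using orthonormal_complete[OF assms] by (intro sum.cong refl) auto
  finally show ?thesis using assms(2) by simp
qed

lemma tendsto_ip:
  assumes "\<And>i. i < n \<Longrightarrow> (\<lambda>m. s m i) \<longlonglongrightarrow> u i" "\<And>i. i < n \<Longrightarrow> (\<lambda>m. t m i) \<longlonglongrightarrow> v i"
  shows "(\<lambda>m. ip n (s m) (t m)) \<longlonglongrightarrow> ip n u v"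
  unfolding ip_def using assms by (auto intro!: tendsto_intros)

lemma tendsto_app:
  assumes "\<And>i. i < n \<Longrightarrow> (\<lambda>m. s m i) \<longlonglongrightarrow> u i"
  shows "(\<lambda>m. app n a (s m) i) \<longlonglongrightarrow> app n a u i"
  unfolding app_def using assms by (auto intro!: tendsto_intros)

text \<open>A minimiser of the Rayleigh quotient on the orthogonal complement of an invariant subspace
  is an eigenvector.\<close>

lemma ex_orthogonal_eigenvector:
  assumes a: "herm n a" and V: "orthonormal n m V" "m < n"
    and eig: "\<And>k i. k < m \<Longrightarrow> i < n \<Longrightarrow> app n a (V k) i = of_real (D k) * V k i"
  shows "\<exists>v \<mu>. ip n v v = 1 \<and> (\<forall>l<m. ip n v (V l) = 0) \<and>
    (\<forall>i<n. app n a v i = of_real \<mu> * v i)"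
proof -
  define S where "S = {v. ip n v v = 1 \<and> (\<forall>l<m. ip n v (V l) = 0)}"
  define f where "f v = Re (ip n (app n a v) v)" for v
  have "\<exists>v\<in>S. \<forall>w\<in>S. f v \<le> f w"
  proof (rule attains_min_coords[where n = n and B = 1])
    show "S \<noteq> {}" using ex_unit_orthogonal[OF V] by (auto simp: S_def)
    show "cmod (v i) \<le> 1" if "v \<in> S" "i < n" for v i
    proof -
      have "complex_of_real (\<Sum>i<n. (cmod (v i))\<^sup>2) = of_real 1"
        using that(1) ip_self[of n v] by (simp add: S_def)
      then have "(\<Sum>i<n. (cmod (v i))\<^sup>2) = 1" by (rule of_real_eq_iff[THEN iffD1])
      moreover have "(cmod (v i))\<^sup>2 \<le> (\<Sum>i<n. (cmod (v i))\<^sup>2)"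
        using that(2) by (intro member_le_sum) auto
      ultimately show ?thesis by (simp add: power_le_one_iff)
    qed
  next
    fix s v assume s: "\<And>m. s m \<in> S" and lim: "\<And>i. i < n \<Longrightarrow> (\<lambda>m. s m i) \<longlonglongrightarrow> v i"
    have "(\<lambda>m. ip n (s m) (s m)) \<longlonglongrightarrow> ip n v v" using lim by (intro tendsto_ip)
    moreover have "ip n v (V l) = 0" if "l < m" for l
    proof -
      have "(\<lambda>m. ip n (s m) (V l)) \<longlonglongrightarrow> ip n v (V l)"
        using lim by (intro tendsto_ip) auto
      moreover have "ip n (s k) (V l) = 0" for k using s that by (simp add: S_def)
      ultimately show ?thesis by (simp add: LIMSEQ_const_iff)
    qed
    ultimately show "v \<in> S"
      using s unfolding S_def by (auto simp: LIMSEQ_const_iff)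
  next
    fix s :: "nat \<Rightarrow> nat \<Rightarrow> complex" and v
    assume "\<And>i. i < n \<Longrightarrow> (\<lambda>m. s m i) \<longlonglongrightarrow> v i"
    then show "(\<lambda>m. f (s m)) \<longlonglongrightarrow> f v"
      unfolding f_def by (intro tendsto_Re tendsto_ip tendsto_app)
  qed
  then obtain v where v: "v \<in> S" "\<And>w. w \<in> S \<Longrightarrow> f v \<le> f w" by blast
  define \<mu> where "\<mu> = f v"
  \<comment> \<open>The form of \<open>a - \<mu>\<close>. By homogeneity the minimality of
    \<open>v\<close> among unit vectors makes it nonnegative on the whole complement of
    \<open>V\<close>, and it vanishes at \<open>v\<close>.\<close>
  define g where "g w = f w - \<mu> * Re (ip n w w)" for w
  have g_nonneg: "0 \<le> g w" if w: "\<And>l. l < m \<Longrightarrow> ip n w (V l) = 0" for w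
  proof (cases "Re (ip n w w) = 0")
    case True
    then have "\<And>i. i < n \<Longrightarrow> w i = 0" using ip_self_eq_0 ip_self_real by (metis of_real_0)
    then have "ip n (app n a w) w = 0" by (simp add: ip_def)
    then show ?thesis using True by (simp add: g_def f_def)
  next
    case False
    define c where "c = Re (ip n w w)"
    have c: "ip n w w = of_real c" "c > 0"
      using False ip_self_real[of n w] ip_self_nonneg[of n w] by (auto simp: c_def less_le)
    define z where "z = (\<lambda>i. of_real (1 / sqrt c) * w i)"
    have sq: "complex_of_real (1 / sqrt c) * of_real (1 / sqrt c) = of_real (1 / c)"
      using c(2) by (simp only: of_real_mult[symmetric]) simp
    have zip: "ip n (app n a z) z = of_real (1 / c) * ip n (app n a w) w"
      "ip n z z = of_real (1 / c) * ip n w w"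
      unfolding z_def app_scale ip_linear complex_cnj_complex_of_real mult.assoc[symmetric] sq by auto
    have "ip n z z = 1" using zip c by simp
    moreover have "\<forall>l<m. ip n z (V l) = 0" using w unfolding z_def ip_linear by simp
    ultimately have "\<mu> \<le> f z" using v(2) by (simp add: S_def \<mu>_def)
    also have "f z = f w / c" by (simp add: f_def zip(1) del: of_real_divide)
    finally show ?thesis using c by (simp add: g_def field_simps)
  qed
  \<comment> \<open>The defect in the eigenvector equation. It is orthogonal to \<open>V\<close>,
    since \<open>a\<close> is Hermitian and \<open>V\<close> consists of eigenvectors, so
    \<open>v - e u\<close> is an admissible competitor.\<close>
  define u where "u = (\<lambda>i. app n a v i - of_real \<mu> * v i)"
  have vW: "ip n v (V l) = 0" if "l < m" for l using v(1) that by (simp add: S_def)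
  have uW: "ip n u (V l) = 0" if "l < m" for l
  proof -
    have "ip n (app n a v) (V l) = ip n v (\<lambda>i. of_real (D l) * V l i)"
      unfolding herm_ip_app[OF a] using eig that by (intro ip_cong) auto
    then show ?thesis using vW[OF that] by (simp add: u_def ip_linear)
  qed
  have gv: "g v = 0" using v(1) by (simp add: g_def S_def \<mu>_def)
  \<comment> \<open>The part linear in \<open>e\<close> is \<open>- 2 * e\<close> times the real
    part of the pairing of \<open>(a - \<mu>) v\<close> with \<open>u\<close>, which is the squared
    norm of \<open>u\<close>.\<close>
  have expand: "g (\<lambda>i. v i - of_real e * u i) = e\<^sup>2 * g u - 2 * e * Re (ip n u u)" for e
  proof -
    have 1: "ip n (app n a u) v = cnj (ip n (app n a v) u)"
      using herm_ip_app[OF a, of u v] ip_cnj[of n u "app n a v"] by simp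
    have 2: "ip n u v = cnj (ip n v u)" by (rule ip_cnj)
    have 3: "Re (ip n u u) = Re (ip n (app n a v) u) - \<mu> * Re (ip n v u)"
      by (subst (1) u_def) (simp add: ip_linear)
    show ?thesis
      using gv by (simp add: g_def f_def app_diff app_scale ip_linear 1 2 3 power2_eq_square algebra_simps)
  qed
  define N where "N = Re (ip n u u)"
  have ineq: "2 * e * N \<le> e\<^sup>2 * g u" for e
    using g_nonneg[of "\<lambda>i. v i - of_real e * u i"] expand[of e] vW uW by (simp add: N_def ip_linear)
  have "N = 0"
  proof (rule ccontr)
    assume "N \<noteq> 0"
    then have N: "N > 0" using ip_self_nonneg[of n u] by (simp add: N_def)
    have G: "0 \<le> g u" using g_nonneg uW by blast
    \<comment> \<open>A small enough step: it makes \<open>e * g u \<le> N\<close>, against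
      \<open>2 * N \<le> e * g u\<close>. The added 1 keeps the denominator positive.\<close>
    define e where "e = N / (1 + g u)"
    have e: "e > 0" using N G by (simp add: e_def)
    have "2 * N \<le> e * g u" using ineq[of e] e by (simp add: power2_eq_square)
    also have "e * g u \<le> N" using N G by (simp add: e_def field_simps)
    finally show False using N by simp
  qed
  then have "ip n u u = 0" using ip_self_real[of n u] by (simp add: N_def)
  then have "\<forall>i<n. app n a v i = of_real \<mu> * v i"
    using ip_self_eq_0 by (fastforce simp: u_def)
  then show ?thesis using v(1) unfolding S_def by blast
qed

lemma ex_orthonormal_eigenvectors:
  assumes a: "herm n a" and "m \<le> n"
  shows "\<exists>V D. orthonormal n m V \<and>
    (\<forall>k<m. \<forall>i<n. app n a (V k) i = of_real (D k) * V k i)"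
  using assms(2)
proof (induction m)
  case 0
  show ?case by (simp add: orthonormal_def)
next
  case (Suc m)
  then obtain V D where V: "orthonormal n m V"
    "\<And>k i. k < m \<Longrightarrow> i < n \<Longrightarrow> app n a (V k) i = of_real (D k) * V k i" by auto
  obtain v \<mu> where v: "ip n v v = 1" "\<And>l. l < m \<Longrightarrow> ip n v (V l) = 0"
    "\<And>i. i < n \<Longrightarrow> app n a v i = of_real \<mu> * v i"
    using ex_orthogonal_eigenvector[OF a V(1) _ V(2)] Suc.prems by force
  have "ip n (V l) v = 0" if "l < m" for l
    using v(2)[OF that] ip_cnj[of n "V l" v] by simp
  then have "orthonormal n (Suc m) (V(m := v))"
    using V(1) v(1,2) by (auto simp: orthonormal_def less_Suc_eq)
  moreover have "\<forall>k<Suc m. \<forall>i<n. app n a ((V(m := v)) k) i = of_real ((D(m := \<mu>)) k) * (V(m := v)) k i"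
    using V(2) v(3) by (auto simp: less_Suc_eq)
  ultimately show ?case by blast
qed

definition eigenbasis :: "nat \<Rightarrow> (nat \<Rightarrow> nat \<Rightarrow> complex) \<Rightarrow> (nat \<Rightarrow> nat \<Rightarrow> complex) \<Rightarrow> (nat \<Rightarrow> real) \<Rightarrow> bool" where
  "eigenbasis n a V D \<longleftrightarrow> orthonormal n n V \<and>
    (\<forall>k<n. \<forall>i<n. app n a (V k) i = of_real (D k) * V k i)"

lemma ex_eigenbasis: "herm n a \<Longrightarrow> \<exists>V D. eigenbasis n a V D"
  using ex_orthonormal_eigenvectors[of n a n] by (simp add: eigenbasis_def)

text \<open>Insert the completeness relation between row \<open>i\<close> of \<open>a\<close> and
  the unit vector \<open>j\<close>. Its main use: matrices that act alike on an orthonormal basis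
  have the same entries.\<close>

lemma entries_from_basis:
  assumes "orthonormal n n V" "i < n" "j < n"
  shows "a i j = (\<Sum>k<n. app n a (V k) i * cnj (V k j))"
proof -
  have "(\<Sum>k<n. app n a (V k) i * cnj (V k j)) = (\<Sum>k<n. \<Sum>l<n. a i l * (V k l * cnj (V k j)))"
    by (simp add: app_def sum_distrib_right mult.assoc)
  also have "\<dots> = (\<Sum>l<n. a i l * (\<Sum>k<n. V k l * cnj (V k j)))"
    unfolding sum_distrib_left by (rule sum.swap)
  also have "\<dots> = (\<Sum>l<n. if l = j then a i l else 0)"
    using orthonormal_complete[OF assms(1) _ assms(3)] by (intro sum.cong refl) auto
  finally show ?thesis using assms by simp
qed

lemma eigenbasis_entries:
  assumes "eigenbasis n a V D" "i < n" "j < n"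
  shows "a i j = (\<Sum>k<n. of_real (D k) * V k i * cnj (V k j))"
  using entries_from_basis[of n V i j a] assms by (simp add: eigenbasis_def)

lemma eigenbasis_eigenvalue:
  assumes "eigenbasis n a V D" "k < n"
  shows "of_real (D k) = ip n (app n a (V k)) (V k)"
proof -
  have "ip n (app n a (V k)) (V k) = ip n (\<lambda>i. of_real (D k) * V k i) (V k)"
    using assms by (intro ip_cong) (auto simp: eigenbasis_def)
  then show ?thesis using assms by (simp add: ip_linear eigenbasis_def orthonormal_def)
qed

section \<open>Positive square roots and the trace norm\<close>

abbreviation entries :: "complex mat \<Rightarrow> nat \<Rightarrow> nat \<Rightarrow> complex" where
  "entries A \<equiv> \<lambda>i j. A $$ (i, j)"

lemma mult_entry:
  assumes "A \<in> carrier_mat n m" "B \<in> carrier_mat m k" "i < n" "j < k"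
  shows "(A * B) $$ (i, j) = (\<Sum>l<m. A $$ (i, l) * B $$ (l, j))"
  using assms by (simp add: scalar_prod_def lessThan_atLeast0)

lemma mat_adjoint_carrier: "A \<in> carrier_mat n m \<Longrightarrow> mat_adjoint A \<in> carrier_mat m n"
  by (auto simp: mat_adjoint_def mat_of_rows_def)

lemma mat_adjoint_entry:
  fixes A :: "complex mat"
  shows "A \<in> carrier_mat n m \<Longrightarrow> i < m \<Longrightarrow> j < n \<Longrightarrow> mat_adjoint A $$ (i, j) = cnj (A $$ (j, i))"
  by (simp add: mat_adjoint_def mat_of_rows_index)

text \<open>Every carrier vector is \<open>vec n\<close> of its own entries, so quantifying over
  carrier vectors and over all coordinate functions amounts to the same.\<close>

lemma psd_iff:
  "psd n A \<longleftrightarrow> A \<in> carrier_mat n n \<and> (\<forall>v. 0 \<le> ip n (app n (entries A) v) v)"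
proof -
  have form: "(A *\<^sub>v vec n v) \<bullet>c vec n v = ip n (app n (entries A) v) v"
    if "A \<in> carrier_mat n n" for v
    using that by (simp add: scalar_prod_def ip_def app_def lessThan_atLeast0)
  have "vec n (\<lambda>i. w $ i) = w" if "w \<in> carrier_vec n" for w :: "complex vec"
    using that by auto
  then have "(\<forall>v\<in>carrier_vec n. 0 \<le> (A *\<^sub>v v) \<bullet>c v) \<longleftrightarrow> (\<forall>v. 0 \<le> (A *\<^sub>v vec n v) \<bullet>c vec n v)"
    by (metis vec_carrier)
  then show ?thesis using form by (auto simp: psd_def)
qed

lemma psd_herm: "psd n A \<Longrightarrow> herm n (entries A)"
  by (rule psd_form_herm) (simp add: psd_iff)

lemma app_mult:
  assumes "A \<in> carrier_mat n n" "B \<in> carrier_mat n n" "i < n"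
  shows "app n (entries (A * B)) v i = app n (entries A) (app n (entries B) v) i"
proof -
  have "app n (entries (A * B)) v i = (\<Sum>j<n. \<Sum>l<n. A $$ (i, l) * (B $$ (l, j) * v j))"
    unfolding app_def using mult_entry[OF assms(1,2,3)]
    by (intro sum.cong) (simp_all add: sum_distrib_right mult.assoc)
  also have "\<dots> = (\<Sum>l<n. \<Sum>j<n. A $$ (i, l) * (B $$ (l, j) * v j))"
    by (rule sum.swap)
  finally show ?thesis by (simp add: app_def sum_distrib_left)
qed

text \<open>An eigenvector of \<open>P\<close> with eigenvalue \<open>\<lambda> \<ge> 0\<close> satisfies \<open>(R + \<lambda>)(R - \<lambda>) v = 0\<close>, and \<open>R + \<lambda>\<close> is
  injective unless \<open>\<lambda> = 0\<close>; so \<open>R\<close> acts as \<open>P\<close> on an eigenbasis of \<open>P\<close>.\<close>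

lemma psd_square_inj:
  assumes P: "psd n P" and R: "psd n R" and eq: "P * P = R * R"
  shows "P = R"
proof -
  let ?p = "app n (entries P)" and ?r = "app n (entries R)"
  have carrier: "P \<in> carrier_mat n n" "R \<in> carrier_mat n n" using P R by (auto simp: psd_iff)
  obtain V D where e: "eigenbasis n (entries P) V D"
    using ex_eigenbasis psd_herm[OF P] by blast
  have V: "orthonormal n n V" using e by (simp add: eigenbasis_def)
  have pV: "?p (V k) i = of_real (D k) * V k i" if "k < n" "i < n" for k i
    using e that by (simp add: eigenbasis_def)
  have rr: "?r (?r (V k)) i = of_real (D k) * (of_real (D k) * V k i)" if "k < n" "i < n" for k i
  proof -
    have "?r (?r (V k)) i = ?p (?p (V k)) i"
      using app_mult[OF carrier(1,1) that(2)] app_mult[OF carrier(2,2) that(2)] eq by simp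
    also have "?p (?p (V k)) i = ?p (\<lambda>i. of_real (D k) * V k i) i"
      using pV that by (simp cong: app_cong)
    finally show ?thesis using pV that by (simp add: app_scale)
  qed
  have rV: "?r (V k) i = of_real (D k) * V k i" if "k < n" "i < n" for k i
  proof (cases "D k = 0")
    case True
    have "ip n (?r (V k)) (?r (V k)) = ip n (?r (?r (V k))) (V k)"
      using herm_ip_app[OF psd_herm[OF R]] by simp
    also have "\<dots> = 0" using rr that(1) True by (simp add: ip_def)
    finally show ?thesis using ip_self_eq_0 that(2) True by simp
  next
    case False
    have "0 \<le> complex_of_real (D k)"
      using eigenbasis_eigenvalue[OF e that(1)] P by (simp add: psd_iff)
    then have D: "D k > 0" using False by (simp add: less_eq_complex_def)
    define u where "u = (\<lambda>i. ?r (V k) i - of_real (D k) * V k i)"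
    have "?r u i = - (of_real (D k) * u i)" if "i < n" for i
      using rr[OF \<open>k < n\<close> that] by (simp add: u_def app_diff app_scale algebra_simps)
    then have "ip n (?r u) u = ip n (\<lambda>i. (- of_real (D k)) * u i) u"
      by (intro ip_cong) auto
    also have "\<dots> = - of_real (D k) * ip n u u" by (rule ip_scale_left)
    finally have "0 \<le> - of_real (D k) * ip n u u" using R by (metis psd_iff)
    then have "D k * Re (ip n u u) \<le> 0" by (simp add: less_eq_complex_def)
    then have "Re (ip n u u) = 0"
      using D ip_self_nonneg[of n u] by (simp add: mult_le_0_iff)
    then have "u i = 0" using ip_self_eq_0 ip_self_real that(2) by (metis of_real_0)
    then show ?thesis by (simp add: u_def)
  qed
  have "P $$ (i, j) = R $$ (i, j)" if "i < n" "j < n" for i j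
    using entries_from_basis[OF V that, of "entries P"] entries_from_basis[OF V that, of "entries R"]
      pV rV that by simp
  then show ?thesis using carrier by (intro eq_matI) auto
qed

lemma op_abs_eqI:
  assumes "dim_col L = n" "psd n P" "P * P = mat_adjoint L * L"
  shows "op_abs L = P"
  unfolding op_abs_def using assms psd_square_inj by (intro the_equality) auto

text \<open>The absolute value keeps the eigenvectors and has the eigenvalues
  \<open>\<bar>D k\<bar>\<close>: the matrix so defined is positive, and its square acts on the
  basis as \<open>A * A\<close>, which is \<open>mat_adjoint A * A\<close>.\<close>

lemma trace_norm_eigenbasis:
  assumes A: "A \<in> carrier_mat n n" and e: "eigenbasis n (entries A) V D"
  shows "trace_norm A = (\<Sum>k<n. \<bar>D k\<bar>)"
proof -
  have V: "orthonormal n n V" using e by (simp add: eigenbasis_def)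
  define P where "P = mat n n (\<lambda>(i, j). \<Sum>k<n. of_real \<bar>D k\<bar> * V k i * cnj (V k j))"
  have Pc: "P \<in> carrier_mat n n" by (simp add: P_def)
  have app_P: "app n (entries P) v i = (\<Sum>k<n. of_real \<bar>D k\<bar> * ip n v (V k) * V k i)" if "i < n" for v i
  proof -
    have "app n (entries P) v i = (\<Sum>j<n. \<Sum>k<n. of_real \<bar>D k\<bar> * V k i * (v j * cnj (V k j)))"
      unfolding app_def using that by (intro sum.cong) (simp_all add: P_def sum_distrib_right sum_distrib_left mult_ac)
    also have "\<dots> = (\<Sum>k<n. \<Sum>j<n. of_real \<bar>D k\<bar> * V k i * (v j * cnj (V k j)))" by (rule sum.swap)
    finally show ?thesis by (simp add: ip_def sum_distrib_left sum_distrib_right mult_ac)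
  qed
  have "0 \<le> ip n (app n (entries P) v) v" for v
  proof -
    have "ip n (app n (entries P) v) v = ip n (\<lambda>i. \<Sum>k<n. (of_real \<bar>D k\<bar> * ip n v (V k)) * V k i) v"
      using app_P by (intro ip_cong) auto
    also have "\<dots> = (\<Sum>k<n. of_real \<bar>D k\<bar> * (ip n v (V k) * cnj (ip n v (V k))))"
      by (simp only: ip_sum_left ip_scale_left ip_cnj[of n "V _" v] mult.assoc)
    also have "\<dots> = of_real (\<Sum>k<n. \<bar>D k\<bar> * (cmod (ip n v (V k)))\<^sup>2)"
      by (simp only: complex_norm_square[symmetric] of_real_mult of_real_sum)
    finally show ?thesis by (simp add: less_eq_complex_def sum_nonneg)
  qed
  then have psd: "psd n P" using Pc by (simp add: psd_iff)
  have appA: "app n (entries A) (V k) i = of_real (D k) * V k i" if "k < n" "i < n" for k i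
    using e that by (simp add: eigenbasis_def)
  have appPV: "app n (entries P) (V k) i = of_real \<bar>D k\<bar> * V k i" if "k < n" "i < n" for k i
  proof -
    have "app n (entries P) (V k) i = (\<Sum>l<n. if l = k then of_real \<bar>D l\<bar> * V l i else 0)"
      unfolding app_P[OF that(2)] using V that(1)
      by (intro sum.cong) (auto simp: orthonormal_def)
    then show ?thesis using that(1) by simp
  qed
  have herm: "mat_adjoint A = A"
  proof (rule eq_matI)
    fix i j assume "i < dim_row A" "j < dim_col A"
    then show "mat_adjoint A $$ (i, j) = A $$ (i, j)"
      using A mat_adjoint_entry[OF A] eigenbasis_entries[OF e, of j i] eigenbasis_entries[OF e, of i j]
      by (simp add: mult_ac)
  qed (use A mat_adjoint_carrier[OF A] in auto)
  have "(P * P) $$ (i, j) = (A * A) $$ (i, j)" if "i < n" "j < n" for i j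
  proof -
    have "app n (entries (P * P)) (V k) i = app n (entries (A * A)) (V k) i" if "k < n" for k
    proof -
      have "app n (entries (P * P)) (V k) i = app n (entries P) (\<lambda>i. of_real \<bar>D k\<bar> * V k i) i"
        unfolding app_mult[OF Pc Pc \<open>i < n\<close>] using appPV that by (simp cong: app_cong)
      also have "\<dots> = app n (entries A) (\<lambda>i. of_real (D k) * V k i) i"
        using appPV[OF that \<open>i < n\<close>] appA[OF that \<open>i < n\<close>]
        by (simp add: app_scale mult.assoc[symmetric] flip: of_real_mult)
      also have "\<dots> = app n (entries (A * A)) (V k) i"
        unfolding app_mult[OF A A \<open>i < n\<close>] using appA that by (simp cong: app_cong)
      finally show ?thesis .
    qed
    then show ?thesis
      using entries_from_basis[OF V that, of "entries (P * P)"]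
        entries_from_basis[OF V that, of "entries (A * A)"] by simp
  qed
  then have "P * P = mat_adjoint A * A"
    unfolding herm using A Pc by (intro eq_matI) auto
  then have "op_abs A = P" using A psd by (intro op_abs_eqI[of _ n]) auto
  then have "tr (op_abs A) = (\<Sum>i<n. \<Sum>k<n. of_real \<bar>D k\<bar> * (V k i * cnj (V k i)))"
    by (simp add: tr_def P_def mult.assoc)
  also have "\<dots> = (\<Sum>k<n. of_real \<bar>D k\<bar> * ip n (V k) (V k))"
    unfolding ip_def sum_distrib_left by (rule sum.swap)
  also have "\<dots> = of_real (\<Sum>k<n. \<bar>D k\<bar>)" using V by (simp add: orthonormal_def)
  finally show ?thesis by (simp add: trace_norm_def)
qed

text \<open>Expanding \<open>A\<close> in eigenvectors gives the sum of \<open>D k\<close> times the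
  form of \<open>q\<close> at \<open>V k\<close>. As \<open>q\<close> lies between zero and the
  identity, these form values have real part in [0, 1]. A test operator thus bounds a trace norm
  from below.\<close>

lemma trace_norm_ge_pairing:
  assumes A: "A \<in> carrier_mat n n" and h: "herm n (entries A)"
    and q: "\<And>v. 0 \<le> Re (ip n (app n q v) v)" "\<And>v. Re (ip n (app n q v) v) \<le> Re (ip n v v)"
  shows "Re (\<Sum>i<n. \<Sum>j<n. A $$ (i, j) * q j i) \<le> trace_norm A"
proof -
  obtain V D where e: "eigenbasis n (entries A) V D" using ex_eigenbasis[OF h] by blast
  have V: "ip n (V k) (V k) = 1" if "k < n" for k using e that by (simp add: eigenbasis_def orthonormal_def)
  have "(\<Sum>i<n. \<Sum>j<n. A $$ (i, j) * q j i)
      = (\<Sum>i<n. \<Sum>j<n. \<Sum>k<n. of_real (D k) * (q j i * V k i * cnj (V k j)))"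
    using eigenbasis_entries[OF e]
    by (intro sum.cong refl) (simp add: sum_distrib_right sum_distrib_left mult_ac)
  also have "\<dots> = (\<Sum>j<n. \<Sum>i<n. \<Sum>k<n. of_real (D k) * (q j i * V k i * cnj (V k j)))"
    by (rule sum.swap)
  also have "\<dots> = (\<Sum>j<n. \<Sum>k<n. \<Sum>i<n. of_real (D k) * (q j i * V k i * cnj (V k j)))"
    by (rule sum.cong[OF refl], rule sum.swap)
  also have "\<dots> = (\<Sum>k<n. \<Sum>j<n. \<Sum>i<n. of_real (D k) * (q j i * V k i * cnj (V k j)))"
    by (rule sum.swap)
  also have "\<dots> = (\<Sum>k<n. of_real (D k) * ip n (app n q (V k)) (V k))"
    by (simp add: ip_def app_def sum_distrib_left sum_distrib_right)
  finally have "Re (\<Sum>i<n. \<Sum>j<n. A $$ (i, j) * q j i) = (\<Sum>k<n. D k * Re (ip n (app n q (V k)) (V k)))"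
    by simp
  also have "\<dots> \<le> (\<Sum>k<n. \<bar>D k\<bar>)"
  proof (rule sum_mono)
    fix k assume "k \<in> {..<n}"
    then have "0 \<le> Re (ip n (app n q (V k)) (V k))" "Re (ip n (app n q (V k)) (V k)) \<le> 1"
      using q[of "V k"] V by auto
    then have "\<bar>D k\<bar> * Re (ip n (app n q (V k)) (V k)) \<le> \<bar>D k\<bar>"
      by (intro mult_left_le) auto
    moreover have "D k * Re (ip n (app n q (V k)) (V k)) \<le> \<bar>D k\<bar> * Re (ip n (app n q (V k)) (V k))"
      using \<open>0 \<le> Re (ip n (app n q (V k)) (V k))\<close> by (intro mult_right_mono) auto
    ultimately show "D k * Re (ip n (app n q (V k)) (V k)) \<le> \<bar>D k\<bar>" by linarith
  qed
  finally show ?thesis using trace_norm_eigenbasis[OF A e] by simp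
qed

text \<open>The matrix is positive and self-adjoint, hence its own absolute value, and its trace is
  \<open>ip n u u\<close>.\<close>

lemma trace_norm_rank_one:
  assumes "ip n u u = 1"
  shows "trace_norm (mat n n (\<lambda>(i, j). u i * cnj (u j))) = 1"
proof -
  define X where "X = mat n n (\<lambda>(i, j). u i * cnj (u j))"
  have X: "X \<in> carrier_mat n n" by (simp add: X_def)
  have app_X: "app n (entries X) v i = ip n v u * u i" if "i < n" for v i
    using that by (simp add: app_def ip_def X_def sum_distrib_left mult_ac)
  have "0 \<le> ip n (app n (entries X) v) v" for v
  proof -
    have "ip n (app n (entries X) v) v = ip n (\<lambda>i. ip n v u * u i) v"
      using app_X by (intro ip_cong) auto
    also have "\<dots> = ip n v u * cnj (ip n v u)"
      by (simp add: ip_scale_left ip_cnj[of n u v])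
    finally have "ip n (app n (entries X) v) v = ip n v u * cnj (ip n v u)" .
    then show ?thesis by (simp add: complex_mult_cnj less_eq_complex_def)
  qed
  then have "psd n X" using X by (simp add: psd_iff)
  moreover have "mat_adjoint X = X"
    using X mat_adjoint_carrier[OF X] mat_adjoint_entry[OF X]
    by (intro eq_matI) (auto simp: X_def mult.commute)
  moreover have "op_abs X = X" if "psd n X" "mat_adjoint X = X"
    using that X by (intro op_abs_eqI) auto
  ultimately have "tr (op_abs X) = ip n u u" by (simp add: X_def tr_def ip_def)
  then show ?thesis using assms by (simp add: trace_norm_def X_def)
qed

section \<open>Diagonal matrices and unitaries\<close>

lemma mat_adjoint_mat_diag: "mat_adjoint (mat_diag n l) = mat_diag n (\<lambda>i. cnj (l i))"
  using mat_adjoint_carrier[of "mat_diag n l" n n] mat_adjoint_entry[of "mat_diag n l" n n]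
  by (intro eq_matI) (auto simp: mat_diag_def)

lemma op_abs_mat_diag: "op_abs (mat_diag n l) = mat_diag n (\<lambda>i. complex_of_real (cmod (l i)))"
proof (rule op_abs_eqI)
  show "psd n (mat_diag n (\<lambda>i. complex_of_real (cmod (l i))))"
  proof -
    have app: "app n (entries (mat_diag n g)) v i = g i * v i" if "i < n" for g v i
    proof -
      have "app n (entries (mat_diag n g)) v i = (\<Sum>j<n. if j = i then g j * v j else 0)"
        unfolding app_def using that by (intro sum.cong) (auto simp: mat_diag_def)
      then show ?thesis using that by simp
    qed
    have "ip n (app n (entries (mat_diag n (\<lambda>i. complex_of_real (cmod (l i))))) v) v
        = of_real (\<Sum>i<n. cmod (l i) * (cmod (v i))\<^sup>2)" for v
      unfolding ip_def of_real_sum of_real_mult complex_norm_square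
      by (simp add: app mult.assoc)
    then show ?thesis by (simp add: psd_iff less_eq_complex_def sum_nonneg)
  qed
  show "mat_diag n (\<lambda>i. complex_of_real (cmod (l i))) * mat_diag n (\<lambda>i. complex_of_real (cmod (l i)))
      = mat_adjoint (mat_diag n l) * mat_diag n l"
    by (simp add: mat_adjoint_mat_diag complex_norm_square[symmetric] mult.commute power2_eq_square)
qed (simp add: mat_diag_def)

text \<open>The numerator is the squared distance of \<open>l\<close> from the vectors with entries
  of modulus 1, so minimising the defect over diagonal operators becomes a problem about
  vectors.\<close>

lemma unitarity_defect_mat_diag:
  "unitarity_defect n (mat_diag n l) = (\<Sum>i<n. (cmod (l i) - 1)\<^sup>2) / real n"
proof -
  have "op_abs (mat_diag n l) - 1\<^sub>m n = mat_diag n (\<lambda>i. complex_of_real (cmod (l i) - 1))"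
    unfolding op_abs_mat_diag by (intro eq_matI) (auto simp: mat_diag_def)
  then have "(op_abs (mat_diag n l) - 1\<^sub>m n) ^\<^sub>m 2 = mat_diag n (\<lambda>i. complex_of_real ((cmod (l i) - 1)\<^sup>2))"
    by (simp add: numeral_2_eq_2)
  then show ?thesis by (simp add: unitarity_defect_def tr_def mat_diag_def)
qed

lemma mat_diag_unitary:
  assumes "\<And>i. i < n \<Longrightarrow> cmod (l i) = 1"
  shows "mat_diag n l \<in> unitaries n"
proof -
  have "l i * cnj (l i) = 1" if "i < n" for i
    using assms[OF that] by (simp add: complex_norm_square[symmetric])
  then have "mat_diag n (\<lambda>i. l i * cnj (l i)) = 1\<^sub>m n" "mat_diag n (\<lambda>i. cnj (l i) * l i) = 1\<^sub>m n"
    by (auto simp: mat_diag_def mult.commute intro!: eq_matI)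
  then show ?thesis by (simp add: unitaries_def mat_adjoint_mat_diag)
qed

text \<open>Each row of a unitary is a unit vector, and the diagonal entry is one of its
  coordinates.\<close>

lemma unitary_diag_le_1:
  assumes "U \<in> unitaries n" "i < n"
  shows "cmod (U $$ (i, i)) \<le> 1"
proof -
  have U: "U \<in> carrier_mat n n" "U * mat_adjoint U = 1\<^sub>m n" using assms by (auto simp: unitaries_def)
  have "(U * mat_adjoint U) $$ (i, i) = (\<Sum>k<n. U $$ (i, k) * cnj (U $$ (i, k)))"
    using mult_entry[OF U(1) mat_adjoint_carrier[OF U(1)] assms(2,2)] mat_adjoint_entry[OF U(1)] assms(2)
    by simp
  then have "complex_of_real (\<Sum>k<n. (cmod (U $$ (i, k)))\<^sup>2) = of_real 1"
    unfolding U(2) of_real_sum complex_norm_square using assms(2) by simp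
  then have "(\<Sum>k<n. (cmod (U $$ (i, k)))\<^sup>2) = 1" by (rule of_real_eq_iff[THEN iffD1])
  moreover have "(cmod (U $$ (i, i)))\<^sup>2 \<le> (\<Sum>k<n. (cmod (U $$ (i, k)))\<^sup>2)"
    using assms(2) by (intro member_le_sum[of i "{..<n}" "\<lambda>k. (cmod (U $$ (i, k)))\<^sup>2"]) auto
  ultimately show ?thesis by (simp add: power_le_one_iff)
qed

section \<open>The Kraus space of a Schur channel\<close>

lemma orthonormal_ip_expand:
  assumes "orthonormal n n V"
  shows "ip n u v = (\<Sum>k<n. ip n u (V k) * cnj (ip n v (V k)))"
proof -
  have "ip n u v = ip n (\<lambda>i. \<Sum>k<n. ip n u (V k) * V k i) v"
    using orthonormal_expand[OF assms] by (intro ip_cong) auto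
  also have "\<dots> = (\<Sum>k<n. ip n u (V k) * ip n (V k) v)"
    by (simp only: ip_sum_left ip_scale_left)
  finally show ?thesis by (simp add: ip_cnj[of n "V _" v])
qed

text \<open>For an eigenbasis \<open>V\<close> with eigenvalues \<open>D\<close> this is the range
  of the matrix, described as the orthogonal complement of its kernel.\<close>

definition spectral_support :: "nat \<Rightarrow> (nat \<Rightarrow> nat \<Rightarrow> complex) \<Rightarrow> (nat \<Rightarrow> real) \<Rightarrow> (nat \<Rightarrow> complex) set" where
  "spectral_support n V D = {v. \<forall>k<n. D k = 0 \<longrightarrow> ip n v (V k) = 0}"

definition support_proj ::
  "nat \<Rightarrow> (nat \<Rightarrow> nat \<Rightarrow> complex) \<Rightarrow> (nat \<Rightarrow> real) \<Rightarrow> nat \<Rightarrow> nat \<Rightarrow> complex" where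
  "support_proj n V D i j = (\<Sum>k<n. if D k = 0 then 0 else V k i * cnj (V k j))"

lemma app_support_proj:
  "app n (support_proj n V D) u i = (\<Sum>k<n. (if D k = 0 then 0 else ip n u (V k)) * V k i)"
proof -
  have "app n (support_proj n V D) u i
      = (\<Sum>j<n. \<Sum>k<n. if D k = 0 then 0 else u j * cnj (V k j) * V k i)"
    unfolding app_def support_proj_def sum_distrib_right by (intro sum.cong refl) auto
  also have "\<dots> = (\<Sum>k<n. \<Sum>j<n. if D k = 0 then 0 else u j * cnj (V k j) * V k i)"
    by (rule sum.swap)
  also have "\<dots> = (\<Sum>k<n. (if D k = 0 then 0 else ip n u (V k)) * V k i)"
    by (intro sum.cong refl) (auto simp: ip_def sum_distrib_right)
  finally show ?thesis .
qed

lemma ip_support_proj: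
  "ip n (app n (support_proj n V D) u) x
    = (\<Sum>k<n. if D k = 0 then 0 else ip n u (V k) * cnj (ip n x (V k)))"
proof -
  have "ip n (app n (support_proj n V D) u) x
      = ip n (\<lambda>i. \<Sum>k<n. (if D k = 0 then 0 else ip n u (V k)) * V k i) x"
    by (intro ip_cong app_support_proj refl)
  also have "\<dots> = (\<Sum>k<n. (if D k = 0 then 0 else ip n u (V k)) * ip n (V k) x)"
    by (simp only: ip_sum_left ip_scale_left)
  also have "\<dots> = (\<Sum>k<n. if D k = 0 then 0 else ip n u (V k) * cnj (ip n x (V k)))"
    by (intro sum.cong refl) (auto simp: ip_cnj[of n "V _" x])
  finally show ?thesis .
qed

lemma ip_support_proj_basis:
  assumes "orthonormal n n V" "l < n"
  shows "ip n (app n (support_proj n V D) u) (V l) = (if D l = 0 then 0 else ip n u (V l))"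
proof -
  have "ip n (app n (support_proj n V D) u) (V l)
      = (\<Sum>k<n. if k = l then if D k = 0 then 0 else ip n u (V k) else 0)"
    unfolding ip_support_proj using assms by (intro sum.cong refl) (auto simp: orthonormal_def)
  then show ?thesis using assms(2) by simp
qed

text \<open>In the basis \<open>V\<close> the projection keeps the coefficients with
  \<open>D k \<noteq> 0\<close> and drops the rest. Pairing with \<open>u\<close> sees only the kept
  ones, which gives the first part; the second compares part of a Parseval sum with all of
  it.\<close>

lemma support_proj_form:
  assumes V: "orthonormal n n V"
  shows "ip n (app n (support_proj n V D) u) u
      = ip n (app n (support_proj n V D) u) (app n (support_proj n V D) u)"
    and "Re (ip n (app n (support_proj n V D) u) u) \<le> Re (ip n u u)"
proof -
  let ?w = "app n (support_proj n V D) u"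
  have "ip n ?w u = (\<Sum>k<n. if D k = 0 then 0 else ip n u (V k) * cnj (ip n u (V k)))"
    by (rule ip_support_proj)
  also have "\<dots> = (\<Sum>k<n. if D k = 0 then 0 else ip n u (V k) * cnj (ip n ?w (V k)))"
    by (intro sum.cong refl) (simp add: ip_support_proj_basis[OF V])
  also have "\<dots> = ip n ?w ?w" by (rule ip_support_proj[symmetric])
  finally show "ip n ?w u = ip n ?w ?w" .
  show "Re (ip n (app n (support_proj n V D) u) u) \<le> Re (ip n u u)"
    unfolding ip_support_proj orthonormal_ip_expand[OF V, of u u] Re_sum
    by (intro sum_mono) auto
qed

lemma support_proj_in_support:
  "orthonormal n n V \<Longrightarrow> app n (support_proj n V D) u \<in> spectral_support n V D"
  by (simp add: spectral_support_def ip_support_proj_basis)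

text \<open>The dropped eigenvectors are those that \<open>a\<close> annihilates, so multiplying by
  the projection does not change \<open>a\<close>. For a Schur matrix the resulting trace is the
  dimension, which is the full overlap of the channel output.\<close>

lemma pairing_support_proj:
  assumes "eigenbasis n a V D"
  shows "(\<Sum>i<n. \<Sum>j<n. a i j * support_proj n V D j i) = (\<Sum>i<n. a i i)"
proof -
  have V: "orthonormal n n V" using assms by (simp add: eigenbasis_def)
  have "(\<Sum>j<n. a i j * support_proj n V D j i) = a i i" if i: "i < n" for i
  proof -
    have "(\<Sum>j<n. a i j * support_proj n V D j i)
        = (\<Sum>j<n. \<Sum>k<n. if D k = 0 then 0 else a i j * V k j * cnj (V k i))"
      unfolding support_proj_def sum_distrib_left by (intro sum.cong refl) auto
    also have "\<dots> = (\<Sum>k<n. \<Sum>j<n. if D k = 0 then 0 else a i j * V k j * cnj (V k i))"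
      by (rule sum.swap)
    also have "\<dots> = (\<Sum>k<n. if D k = 0 then 0 else app n a (V k) i * cnj (V k i))"
      by (intro sum.cong refl) (auto simp: app_def sum_distrib_right)
    also have "\<dots> = (\<Sum>k<n. app n a (V k) i * cnj (V k i))"
      using assms i by (intro sum.cong refl) (auto simp: eigenbasis_def)
    finally show ?thesis using entries_from_basis[OF V i i, of a] by simp
  qed
  then show ?thesis by simp
qed

section \<open>Spans of sets of matrices\<close>

lemma span_mat_subset:
  fixes A N :: "complex mat set"
  assumes "A \<subseteq> N" "N \<subseteq> carrier_mat m n" "0\<^sub>m m n \<in> N"
    and "\<And>x y. x \<in> N \<Longrightarrow> y \<in> N \<Longrightarrow> x + y \<in> N" "\<And>c x. x \<in> N \<Longrightarrow> c \<cdot>\<^sub>m x \<in> N"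
  shows "LinearCombinations.module.span class_ring (module_mat TYPE(complex) m n) A \<subseteq> N"
proof -
  interpret matrix_vs m n "TYPE(complex)" .
  have "submodule class_ring N (module_mat TYPE(complex) m n)"
    using assms module_axioms by (intro submodule.intro) (auto simp: module_mat_simps class_ring_simps)
  then show ?thesis using assms(1) by (intro span_is_subset)
qed

lemma span_mat_superset:
  fixes A :: "complex mat set"
  assumes A: "A \<subseteq> carrier_mat m n"
  defines "sp \<equiv> LinearCombinations.module.span class_ring (module_mat TYPE(complex) m n) A"
  shows "A \<subseteq> sp" "0\<^sub>m m n \<in> sp"
    and "\<And>x y. x \<in> sp \<Longrightarrow> y \<in> sp \<Longrightarrow> x + y \<in> sp" "\<And>c x. x \<in> sp \<Longrightarrow> c \<cdot>\<^sub>m x \<in> sp"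
proof -
  interpret matrix_vs m n "TYPE(complex)" .
  have sub: "submodule class_ring sp (module_mat TYPE(complex) m n)"
    unfolding sp_def using A by (intro span_is_submodule) (simp add: module_mat_simps)
  show "A \<subseteq> sp" unfolding sp_def using A by (intro in_own_span) (simp add: module_mat_simps)
  show "0\<^sub>m m n \<in> sp"
    using sub by (auto simp: submodule_def module_mat_simps)
  show "x + y \<in> sp" if "x \<in> sp" "y \<in> sp" for x y
    using sub that by (auto simp: submodule_def module_mat_simps)
  show "c \<cdot>\<^sub>m x \<in> sp" if "x \<in> sp" for c x
    using sub that by (auto simp: submodule_def module_mat_simps class_ring_simps)
qed

section \<open>Kraus operators of a Schur channel\<close>

lemma matrix_unit_carrier [simp]: "matrix_unit n a b \<in> carrier_mat n n"
  by (simp add: matrix_unit_def)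

lemma conjugated_matrix_unit_entry:
  assumes E: "E \<in> carrier_mat n n" and "a < n" "b < n" "i < n" "j < n"
  shows "(E * matrix_unit n a b * mat_adjoint E) $$ (i, j) = E $$ (i, a) * cnj (E $$ (j, b))"
proof -
  have 1: "(E * matrix_unit n a b) $$ (i, l) = (if l = b then E $$ (i, a) else 0)" if "l < n" for l
  proof -
    have "(E * matrix_unit n a b) $$ (i, l) = (\<Sum>k<n. if k = a then if l = b then E $$ (i, k) else 0 else 0)"
      unfolding mult_entry[OF E matrix_unit_carrier \<open>i < n\<close> that]
      using that by (intro sum.cong refl) (auto simp: matrix_unit_def)
    then show ?thesis using \<open>a < n\<close> by simp
  qed
  have c: "E * matrix_unit n a b \<in> carrier_mat n n" using E by (intro mult_carrier_mat) auto
  have "(E * matrix_unit n a b * mat_adjoint E) $$ (i, j)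
      = (\<Sum>l<n. if l = b then E $$ (i, a) * cnj (E $$ (j, l)) else 0)"
    unfolding mult_entry[OF c mat_adjoint_carrier[OF E] \<open>i < n\<close> \<open>j < n\<close>]
    using 1 mat_adjoint_entry[OF E] \<open>j < n\<close> by (intro sum.cong refl) auto
  then show ?thesis using \<open>b < n\<close> by simp
qed

lemma schur_product_matrix_unit:
  "i < n \<Longrightarrow> j < n \<Longrightarrow>
    schur_product S (matrix_unit n a b) $$ (i, j) = (if i = a \<and> j = b then S $$ (a, b) else 0)"
  by (auto simp: schur_product_def matrix_unit_def)

text \<open>Each rank one term of the spectral decomposition of \<open>S\<close> acts by Schur
  product as conjugation with a diagonal operator. That a representation exists gives meaning to the
  choice in \<open>kraus_space\<close>.\<close>

lemma kraus_rep_diagonal_operators: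
  assumes e: "eigenbasis d (entries S) V D" and D: "\<And>k. k < d \<Longrightarrow> 0 \<le> D k"
    and \<Phi>: "\<And>X. X \<in> carrier_mat d d \<Longrightarrow> \<Phi> X = schur_product S X"
  shows "kraus_rep d (map (\<lambda>k. mat_diag d (\<lambda>i. of_real (sqrt (D k)) * V k i)) [0..<d]) \<Phi>"
proof -
  define E where "E k = mat_diag d (\<lambda>i. complex_of_real (sqrt (D k)) * V k i)" for k
  have entry: "(E k * X * mat_adjoint (E k)) $$ (i, j) = X $$ (i, j) * (of_real (D k) * V k i * cnj (V k j))"
    if "k < d" "i < d" "j < d" "X \<in> carrier_mat d d" for X k i j
  proof -
    have sq: "complex_of_real (sqrt (D k)) * complex_of_real (sqrt (D k)) = of_real (D k)"
      using D[OF that(1)] by (simp flip: of_real_mult)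
    have "E k * X = mat d d (\<lambda>(i, j). of_real (sqrt (D k)) * V k i * X $$ (i, j))"
      unfolding E_def by (rule mat_diag_mult_left[OF that(4)])
    then have "(E k * X * mat_adjoint (E k)) $$ (i, j)
        = (of_real (sqrt (D k)) * V k i * X $$ (i, j)) * (of_real (sqrt (D k)) * cnj (V k j))"
      using that by (simp add: E_def mat_adjoint_mat_diag mat_diag_mult_right[of _ d d])
    then show ?thesis by (simp add: sq[symmetric])
  qed
  have "\<Phi> X = mat_sum d (\<lambda>k. E k * X * mat_adjoint (E k)) {..<d}" if X: "X \<in> carrier_mat d d" for X
    unfolding \<Phi>[OF X] using X eigenbasis_entries[OF e]
    by (intro eq_matI) (auto simp: schur_product_def mat_sum_def entry sum_distrib_left[symmetric] mult.commute)
  moreover have "mat_sum d (\<lambda>k. map E [0..<d] ! k * X * mat_adjoint (map E [0..<d] ! k)) {..<d}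
      = mat_sum d (\<lambda>k. E k * X * mat_adjoint (E k)) {..<d}" for X
    unfolding mat_sum_def by (intro arg_cong[of _ _ "mat d d"] ext) auto
  ultimately have "kraus_rep d (map E [0..<d]) \<Phi>" by (auto simp: kraus_rep_def E_def)
  then show ?thesis by (simp add: E_def[abs_def])
qed

text \<open>The argument must serve whichever representation \<open>SOME\<close> selects. Evaluation
  at matrix units shows that its operators are diagonal, with diagonals \<open>f k\<close>, and that
  \<open>S\<close> is the sum of the rank one matrices of the \<open>f k\<close>; hence the
  \<open>f k\<close> span the range of \<open>S\<close>.\<close>

lemma kraus_space_schur:
  assumes S: "psd d S" and \<Phi>: "\<And>X. X \<in> carrier_mat d d \<Longrightarrow> \<Phi> X = schur_product S X"
    and e: "eigenbasis d (entries S) V D"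
  shows "kraus_space d \<Phi> = mat_diag d ` spectral_support d V D"
proof -
  have V: "orthonormal d d V" using e by (simp add: eigenbasis_def)
  have D: "0 \<le> D k" if "k < d" for k
  proof -
    have "0 \<le> complex_of_real (D k)" using eigenbasis_eigenvalue[OF e that] S by (simp add: psd_iff)
    then show ?thesis by (simp add: less_eq_complex_def)
  qed
  define Es where "Es = (SOME Es. kraus_rep d Es \<Phi>)"
  have rep: "kraus_rep d Es \<Phi>"
    unfolding Es_def by (rule someI, rule kraus_rep_diagonal_operators[OF e D \<Phi>])
  define r where "r = length Es"
  have Es: "Es ! k \<in> carrier_mat d d" if "k < r" for k
    using rep that by (auto simp: kraus_rep_def r_def)
  have entry: "(\<Sum>k<r. Es ! k $$ (i, a) * cnj (Es ! k $$ (j, b))) = (if i = a \<and> j = b then S $$ (a, b) else 0)"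
    if "i < d" "j < d" "a < d" "b < d" for i j a b
  proof -
    have "\<Phi> (matrix_unit d a b) = mat_sum d (\<lambda>k. Es ! k * matrix_unit d a b * mat_adjoint (Es ! k)) {..<r}"
      using rep by (simp add: kraus_rep_def r_def)
    then have "\<Phi> (matrix_unit d a b) $$ (i, j) = (\<Sum>k<r. Es ! k $$ (i, a) * cnj (Es ! k $$ (j, b)))"
      using that Es by (simp add: mat_sum_def conjugated_matrix_unit_entry)
    then show ?thesis using \<Phi>[OF matrix_unit_carrier] schur_product_matrix_unit that by metis
  qed
  define f where "f k i = Es ! k $$ (i, i)" for k i
  \<comment> \<open>Apply \<open>entry\<close> to the unit at \<open>(a, a)\<close> and the place
    \<open>(i, i)\<close>: a sum of squared moduli equals \<open>0\<close>.\<close>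
  have off: "Es ! k $$ (i, a) = 0" if "k < r" "i < d" "a < d" "i \<noteq> a" for k i a
  proof -
    have "complex_of_real (\<Sum>k<r. (cmod (Es ! k $$ (i, a)))\<^sup>2) = 0"
      unfolding of_real_sum complex_norm_square using entry[of i i a a] that by simp
    then have "(\<Sum>k<r. (cmod (Es ! k $$ (i, a)))\<^sup>2) = 0" by (rule of_real_eq_0_iff[THEN iffD1])
    then show ?thesis using that(1) by (subst (asm) sum_nonneg_eq_0_iff) auto
  qed
  have Es_diag: "Es ! k = mat_diag d (f k)" if "k < r" for k
    using Es[OF that] off[OF that] by (intro eq_matI) (auto simp: mat_diag_def f_def)
  have S_entry: "S $$ (i, j) = (\<Sum>k<r. f k i * cnj (f k j))" if "i < d" "j < d" for i j
    using entry[of i j i j] that by (simp add: f_def)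
  have app_S: "app d (entries S) v i = (\<Sum>k<r. ip d v (f k) * f k i)" if "i < d" for v i
  proof -
    have "app d (entries S) v i = (\<Sum>j<d. \<Sum>k<r. v j * cnj (f k j) * f k i)"
      unfolding app_def using that
      by (intro sum.cong refl) (simp add: S_entry sum_distrib_left mult_ac)
    also have "\<dots> = (\<Sum>k<r. \<Sum>j<d. v j * cnj (f k j) * f k i)" by (rule sum.swap)
    finally show ?thesis by (simp add: ip_def sum_distrib_right)
  qed
  have support: "f k \<in> spectral_support d V D" if k: "k < r" for k
  proof -
    have "ip d (f k) (V l) = 0" if l: "l < d" "D l = 0" for l
    proof -
      \<comment> \<open>The form of \<open>S\<close> at the null vector \<open>V l\<close> is the
        sum of the squared moduli of \<open>ip d (f k) (V l)\<close>, so each of these is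
        \<open>0\<close>.\<close>
      have "0 = ip d (app d (entries S) (V l)) (V l)"
        using eigenbasis_eigenvalue[OF e l(1)] l(2) by simp
      also have "\<dots> = ip d (\<lambda>i. \<Sum>k<r. ip d (V l) (f k) * f k i) (V l)"
        using app_S by (intro ip_cong) auto
      also have "\<dots> = (\<Sum>k<r. ip d (V l) (f k) * ip d (f k) (V l))"
        by (simp only: ip_sum_left ip_scale_left)
      also have "\<dots> = (\<Sum>k<r. ip d (f k) (V l) * cnj (ip d (f k) (V l)))"
        by (intro sum.cong refl) (simp add: ip_cnj[of d "V l" "f _"])
      also have "\<dots> = of_real (\<Sum>k<r. (cmod (ip d (f k) (V l)))\<^sup>2)"
        by (simp only: of_real_sum complex_norm_square)
      finally have "(\<Sum>k<r. (cmod (ip d (f k) (V l)))\<^sup>2) = 0" by (metis of_real_eq_0_iff)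
      then show ?thesis using k by (subst (asm) sum_nonneg_eq_0_iff) auto
    qed
    then show ?thesis by (simp add: spectral_support_def)
  qed
  have Es_carrier: "set Es \<subseteq> carrier_mat d d" using rep by (simp add: kraus_rep_def)
  define sp where "sp = LinearCombinations.module.span class_ring (module_mat TYPE(complex) d d) (set Es)"
  have zero: "mat_diag d (\<lambda>_. 0) = 0\<^sub>m d d" for d
    by (intro eq_matI) (auto simp: mat_diag_def)
  have add: "mat_diag d u + mat_diag d v = mat_diag d (\<lambda>i. u i + v i)" for d and u v :: "nat \<Rightarrow> complex"
    by (intro eq_matI) (auto simp: mat_diag_def)
  have smult: "c \<cdot>\<^sub>m mat_diag d v = mat_diag d (\<lambda>i. c * v i)" for d c and v :: "nat \<Rightarrow> complex"
    by (intro eq_matI) (auto simp: mat_diag_def)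
  have "sp \<subseteq> mat_diag d ` spectral_support d V D"
    unfolding sp_def
  proof (rule span_mat_subset)
    show "set Es \<subseteq> mat_diag d ` spectral_support d V D"
      using Es_diag support by (auto simp: in_set_conv_nth r_def)
    show "0\<^sub>m d d \<in> mat_diag d ` spectral_support d V D"
      by (rule image_eqI[of _ _ "\<lambda>_. 0"]) (auto simp: zero spectral_support_def ip_def)
  qed (auto simp: add smult spectral_support_def ip_linear intro!: imageI)
  moreover have "mat_diag d v \<in> sp" if v: "v \<in> spectral_support d V D" for v
  proof -
    note sp = span_mat_superset[OF Es_carrier, folded sp_def]
    \<comment> \<open>A preimage of \<open>v\<close> under \<open>S\<close>, found by dividing by
      the nonzero eigenvalues. Through \<open>app_S\<close> the equation \<open>v = S w\<close>
      exhibits \<open>v\<close> as a combination of the \<open>f k\<close>.\<close>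
    define w where "w = (\<lambda>i. \<Sum>k<d. (if D k = 0 then 0 else ip d v (V k) / of_real (D k)) * V k i)"
    have "app d (entries S) w i = v i" if i: "i < d" for i
    proof -
      have "app d (entries S) w i
          = (\<Sum>k<d. (if D k = 0 then 0 else ip d v (V k) / of_real (D k)) * app d (entries S) (V k) i)"
        by (simp only: w_def app_sum app_scale)
      also have "\<dots> = (\<Sum>k<d. ip d v (V k) * V k i)"
        using v e i by (intro sum.cong refl) (auto simp: spectral_support_def eigenbasis_def)
      finally show ?thesis using orthonormal_expand[OF V i, of v] by simp
    qed
    then have "mat_diag d v = mat_diag d (\<lambda>i. \<Sum>k<r. ip d w (f k) * f k i)"
      using app_S by (intro eq_matI) (auto simp: mat_diag_def)
    moreover have "mat_diag d (\<lambda>i. \<Sum>k<m. c k * f k i) \<in> sp" if "m \<le> r" for m c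
      using that
    proof (induction m)
      case 0
      show ?case using sp(2) by (simp add: zero)
    next
      case (Suc m)
      have "Es ! m \<in> sp" using sp(1) Suc.prems by (auto simp: r_def)
      then have "c m \<cdot>\<^sub>m mat_diag d (f m) \<in> sp" using sp(4) Es_diag[of m] Suc.prems by simp
      then show ?case using sp(3) Suc by (auto simp: smult simp flip: add)
    qed
    ultimately show ?thesis by simp
  qed
  ultimately have "sp = mat_diag d ` spectral_support d V D" by blast
  then show ?thesis by (simp add: kraus_space_def sp_def Es_def)
qed

section \<open>The attained minimum and the bound on overlaps\<close>

lemma ex_min_unit_modulus_distance:
  "\<exists>l\<in>spectral_support d V D. \<forall>w\<in>spectral_support d V D.
    (\<Sum>i<d. (cmod (l i) - 1)\<^sup>2) \<le> (\<Sum>i<d. (cmod (w i) - 1)\<^sup>2)"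
proof -
  define f where "f l = (\<Sum>i<d. (cmod (l i) - 1)\<^sup>2)" for l :: "nat \<Rightarrow> complex"
  \<comment> \<open>The support is a subspace, so a bounded part has to be cut out. The radius
    suffices because an entry of modulus above \<open>1 + real d\<close> alone contributes at least
    \<open>d\<^sup>2 \<ge> d\<close>, and \<open>d\<close> is the value at the zero vector.\<close>
  define K where "K = {l \<in> spectral_support d V D. \<forall>i<d. cmod (l i) \<le> 1 + real d}"
  have zero: "(\<lambda>_. 0) \<in> K" by (simp add: K_def spectral_support_def ip_def)
  have "\<exists>l\<in>K. \<forall>w\<in>K. f l \<le> f w"
  proof (rule attains_min_coords[where n = d and B = "1 + real d"])
    show "K \<noteq> {}" using zero by blast
    show "cmod (v i) \<le> 1 + real d" if "v \<in> K" "i < d" for v i using that by (simp add: K_def)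
  next
    fix s v assume s: "\<And>m. s m \<in> K" and lim: "\<And>i. i < d \<Longrightarrow> (\<lambda>m. s m i) \<longlonglongrightarrow> v i"
    have "ip d v (V l) = 0" if "l < d" "D l = 0" for l
    proof -
      have "(\<lambda>m. ip d (s m) (V l)) \<longlonglongrightarrow> ip d v (V l)" using lim by (intro tendsto_ip) auto
      moreover have "ip d (s m) (V l) = 0" for m
        using s[of m] that by (simp add: K_def spectral_support_def)
      ultimately show ?thesis by (simp add: LIMSEQ_const_iff)
    qed
    moreover have "cmod (v i) \<le> 1 + real d" if "i < d" for i
      using tendsto_norm[OF lim[OF that]] s that by (intro LIMSEQ_le_const2) (auto simp: K_def)
    ultimately show "v \<in> K" by (simp add: K_def spectral_support_def)
  next
    fix s :: "nat \<Rightarrow> nat \<Rightarrow> complex" and v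
    assume "\<And>i. i < d \<Longrightarrow> (\<lambda>m. s m i) \<longlonglongrightarrow> v i"
    then show "(\<lambda>m. f (s m)) \<longlonglongrightarrow> f v" unfolding f_def by (auto intro!: tendsto_intros)
  qed
  then obtain l where l: "l \<in> K" "\<And>w. w \<in> K \<Longrightarrow> f l \<le> f w" by blast
  have "f l \<le> f w" if w: "w \<in> spectral_support d V D" for w
  proof (cases "w \<in> K")
    case False
    then obtain i where i: "i < d" "1 + real d < cmod (w i)" using w by (auto simp: K_def not_le)
    have "f l \<le> f (\<lambda>_. 0)" using l(2) zero by blast
    also have "\<dots> = real d" by (simp add: f_def)
    also have "\<dots> \<le> (real d)\<^sup>2" using i(1) by (simp add: power2_eq_square)
    also have "\<dots> \<le> (cmod (w i) - 1)\<^sup>2" using i(2) by (intro power_mono) auto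
    also have "\<dots> \<le> f w"
      unfolding f_def using i(1) by (intro member_le_sum[of i "{..<d}" "\<lambda>i. (cmod (w i) - 1)\<^sup>2"]) auto
    finally show ?thesis .
  qed (use l in blast)
  then show ?thesis using l(1) by (auto simp: f_def K_def)
qed

lemma support_proj_form_le:
  assumes V: "orthonormal d d V" and u: "\<And>i. i < d \<Longrightarrow> cmod (u i) \<le> 1"
    and c: "\<And>w. w \<in> spectral_support d V D \<Longrightarrow> c \<le> (\<Sum>i<d. (cmod (w i) - 1)\<^sup>2)"
  shows "Re (ip d (app d (support_proj d V D) u) u) \<le> real d - c"
proof -
  define w where "w = app d (support_proj d V D) u"
  have norm: "Re (ip d w w) = (\<Sum>i<d. (cmod (w i))\<^sup>2)" by (simp add: ip_self)
  have "Re (ip d w w) = Re (ip d w u)" using support_proj_form(1)[OF V] by (simp add: w_def)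
  also have "\<dots> \<le> (\<Sum>i<d. cmod (w i))"
    unfolding ip_def Re_sum
  proof (rule sum_mono)
    fix i assume "i \<in> {..<d}"
    have "Re (w i * cnj (u i)) \<le> cmod (w i) * cmod (u i)"
      by (metis complex_Re_le_cmod complex_mod_cnj norm_mult)
    also have "\<dots> \<le> cmod (w i)" using u \<open>i \<in> {..<d}\<close> by (intro mult_left_le) auto
    finally show "Re (w i * cnj (u i)) \<le> cmod (w i)" .
  qed
  finally have le: "Re (ip d w w) \<le> (\<Sum>i<d. cmod (w i))" .
  have "c \<le> (\<Sum>i<d. (cmod (w i) - 1)\<^sup>2)"
    using c support_proj_in_support[OF V] by (simp add: w_def)
  \<comment> \<open>With \<open>le\<close> this is at most \<open>real d\<close> minus the squared
    norm of \<open>w\<close>, because the linear term carries the factor 2.\<close>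
  also have "\<dots> = Re (ip d w w) - 2 * (\<Sum>i<d. cmod (w i)) + real d"
    by (simp add: norm power2_diff sum.distrib sum_subtractf sum_distrib_left)
  finally have "Re (ip d w w) \<le> real d - c" using le by linarith
  then show ?thesis using support_proj_form(1)[OF V] by (simp add: w_def)
qed

section \<open>Tensor powers and the lower bound\<close>

text \<open>The trace of the product of \<open>a\<close> and \<open>q\<close>, hence the transposed
  indices.\<close>

definition pairing :: "nat \<Rightarrow> (nat \<Rightarrow> nat \<Rightarrow> complex) \<Rightarrow> (nat \<Rightarrow> nat \<Rightarrow> complex) \<Rightarrow> complex" where
  "pairing n a q = (\<Sum>i<n. \<Sum>j<n. a i j * q j i)"

lemma pairing_rank_one: "pairing n (\<lambda>i j. v i * cnj (v j)) q = ip n (app n q v) v"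
proof -
  have "pairing n (\<lambda>i j. v i * cnj (v j)) q = (\<Sum>j<n. \<Sum>i<n. v i * cnj (v j) * q j i)"
    unfolding pairing_def by (rule sum.swap)
  then show ?thesis by (simp add: ip_def app_def sum_distrib_left mult_ac)
qed

text \<open>Splits an index in the way \<open>kron\<close> numbers product basis vectors.\<close>

lemma sum_lessThan_mult:
  fixes f :: "nat \<Rightarrow> 'a :: comm_monoid_add"
  shows "(\<Sum>p<a * b. f p) = (\<Sum>i<a. \<Sum>j<b. f (i * b + j))"
proof -
  have "sum f {i * b..<i * b + b} = (\<Sum>j<b. f (i * b + j))" for i
    by (simp add: sum.atLeastLessThan_shift_0[of f "i * b"] lessThan_atLeast0)
  then show ?thesis by (simp add: sum.nat_group[symmetric])
qed

lemma sum_diagonal_index: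
  fixes g :: "nat \<Rightarrow> 'a :: comm_monoid_add"
  shows "(\<Sum>p<n * n. if p div n = p mod n then g p else 0) = (\<Sum>i<n. g (i * n + i))"
proof -
  have "(\<Sum>j<n. if (i * n + j) div n = (i * n + j) mod n then g (i * n + j) else 0) = g (i * n + i)"
    if "i < n" for i
  proof -
    have "(\<Sum>j<n. if (i * n + j) div n = (i * n + j) mod n then g (i * n + j) else 0)
        = (\<Sum>j<n. if j = i then g (i * n + j) else 0)"
      by (intro sum.cong refl) auto
    then show ?thesis using that by simp
  qed
  then show ?thesis by (simp add: sum_lessThan_mult)
qed

text \<open>The operator \<open>\<pi>\<close> on the span of the vectors \<open>e\<^sub>i \<otimes> e\<^sub>i\<close>, extended by zero.\<close>

definition diagonal_embedding :: "nat \<Rightarrow> (nat \<Rightarrow> nat \<Rightarrow> complex) \<Rightarrow> nat \<Rightarrow> nat \<Rightarrow> complex" where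
  "diagonal_embedding n \<pi> p q =
    (if p div n = p mod n \<and> q div n = q mod n then \<pi> (p div n) (q div n) else 0)"

lemma pairing_diagonal_embedding:
  "pairing (n * n) a (diagonal_embedding n \<pi>) = pairing n (\<lambda>i j. a (i * n + i) (j * n + j)) \<pi>"
proof -
  have "pairing (n * n) a (diagonal_embedding n \<pi>) = (\<Sum>p<n * n. if p div n = p mod n then
      (\<Sum>q<n * n. if q div n = q mod n then a p q * \<pi> (q div n) (p div n) else 0) else 0)"
    unfolding pairing_def diagonal_embedding_def by (intro sum.cong refl) (auto intro!: sum.cong)
  also have "\<dots> = (\<Sum>i<n. \<Sum>j<n.
      a (i * n + i) (j * n + j) * \<pi> ((j * n + j) div n) ((i * n + i) div n))"
    unfolding sum_diagonal_index ..
  finally show ?thesis by (simp add: pairing_def)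
qed

text \<open>The operator \<open>\<pi> \<otimes> I\<^sub>m\<close>.\<close>

definition tensor_identity :: "nat \<Rightarrow> (nat \<Rightarrow> nat \<Rightarrow> complex) \<Rightarrow> nat \<Rightarrow> nat \<Rightarrow> complex" where
  "tensor_identity m \<pi> i j = (if i mod m = j mod m then \<pi> (i div m) (j div m) else 0)"

text \<open>The identity on the second factor forces the same digit \<open>r\<close> in both
  indices, leaving one \<open>d\<close>-dimensional block for each \<open>r\<close>.\<close>

lemma pairing_tensor_identity:
  "pairing (d * m) a (tensor_identity m \<pi>)
    = (\<Sum>r<m. pairing d (\<lambda>i j. a (i * m + r) (j * m + r)) \<pi>)"
proof -
  have inner: "(\<Sum>q<d * m. a p q * tensor_identity m \<pi> q p) = (\<Sum>j<d. a p (j * m + r) * \<pi> j i)"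
    if "r < m" "p = i * m + r" for i r p
  proof -
    have "(\<Sum>s<m. a p (j * m + s) * tensor_identity m \<pi> (j * m + s) p) = a p (j * m + r) * \<pi> j i" for j
    proof -
      have "(\<Sum>s<m. a p (j * m + s) * tensor_identity m \<pi> (j * m + s) p)
          = (\<Sum>s<m. if s = r then a p (j * m + s) * \<pi> j i else 0)"
        using that by (intro sum.cong refl) (auto simp: tensor_identity_def)
      then show ?thesis using that(1) by simp
    qed
    then show ?thesis by (simp add: sum_lessThan_mult)
  qed
  have "pairing (d * m) a (tensor_identity m \<pi>)
      = (\<Sum>i<d. \<Sum>r<m. \<Sum>j<d. a (i * m + r) (j * m + r) * \<pi> j i)"
    unfolding pairing_def sum_lessThan_mult[of "\<lambda>p. \<Sum>q<d * m. a p q * tensor_identity m \<pi> q p"]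
    by (rule sum.cong[OF refl], rule sum.cong[OF refl], rule inner[OF _ refl]) simp
  also have "\<dots> = (\<Sum>r<m. \<Sum>i<d. \<Sum>j<d. a (i * m + r) (j * m + r) * \<pi> j i)" by (rule sum.swap)
  finally show ?thesis by (simp add: pairing_def)
qed

section \<open>Tensor products of entrywise maps\<close>

lemma mat_sum_carrier [simp]: "mat_sum n f I \<in> carrier_mat n n"
  by (simp add: mat_sum_def)

lemma tensor_map_carrier [simp]: "tensor_map d \<Phi> m \<Psi> X \<in> carrier_mat (d * m) (d * m)"
  by (simp add: tensor_map_def)

lemma matrix_unit_entry:
  "i < n \<Longrightarrow> j < n \<Longrightarrow> matrix_unit n a b $$ (i, j) = (if i = a \<and> j = b then 1 else 0)"
  by (simp add: matrix_unit_def)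

lemma tensor_map_entry:
  assumes "\<And>a b. a < d \<Longrightarrow> b < d \<Longrightarrow> \<Phi> (matrix_unit d a b) \<in> carrier_mat d d"
    and "\<And>a b. a < m \<Longrightarrow> b < m \<Longrightarrow> \<Psi> (matrix_unit m a b) \<in> carrier_mat m m"
    and "i < d * m" "j < d * m"
  shows "tensor_map d \<Phi> m \<Psi> X $$ (i, j) =
    (\<Sum>(a, b, c, e)\<in>{..<d} \<times> {..<d} \<times> {..<m} \<times> {..<m}. X $$ (a * m + c, b * m + e) *
      (\<Phi> (matrix_unit d a b) $$ (i div m, j div m) * \<Psi> (matrix_unit m c e) $$ (i mod m, j mod m)))"
proof -
  have "(X $$ (a * m + c, b * m + e) \<cdot>\<^sub>m kron (\<Phi> (matrix_unit d a b)) (\<Psi> (matrix_unit m c e))) $$ (i, j)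
      = X $$ (a * m + c, b * m + e) *
      (\<Phi> (matrix_unit d a b) $$ (i div m, j div m) * \<Psi> (matrix_unit m c e) $$ (i mod m, j mod m))"
    if "a < d" "b < d" "c < m" "e < m" for a b c e
    using assms(1)[OF that(1,2)] assms(2)[OF that(3,4)] assms(3,4) by (simp add: kron_def)
  then show ?thesis
    unfolding tensor_map_def mat_sum_def using assms(3,4)
    by (auto intro!: sum.cong)
qed

lemma sum_single:
  assumes "finite A" "x \<in> A" "\<And>y. y \<in> A \<Longrightarrow> y \<noteq> x \<Longrightarrow> f y = 0"
  shows "sum f A = (f x :: 'a :: comm_monoid_add)"
  using assms by (subst sum.remove[OF assms(1,2)]) (auto intro!: sum.neutral)

text \<open>Schur multiplication by \<open>s\<close>, recorded on matrix units only. These are the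
  only arguments at which \<open>tensor_map\<close> evaluates its component maps, and the property
  passes to tensor products.\<close>

definition entrywise_map :: "nat \<Rightarrow> (complex mat \<Rightarrow> complex mat) \<Rightarrow> (nat \<Rightarrow> nat \<Rightarrow> complex) \<Rightarrow> bool" where
  "entrywise_map d \<Phi> s \<longleftrightarrow> (\<forall>a<d. \<forall>b<d. \<Phi> (matrix_unit d a b) \<in> carrier_mat d d \<and>
    (\<forall>i<d. \<forall>j<d. \<Phi> (matrix_unit d a b) $$ (i, j) = (if i = a \<and> j = b then s a b else 0)))"

lemma index_div_mod_less:
  fixes i d m :: nat
  assumes "i < d * m"
  shows "i div m < d" "i mod m < m"
  using assms by (auto simp: less_mult_imp_div_less) (metis mod_less_divisor mult_0_right not_less0 neq0_conv)

lemma entrywise_map_tensor: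
  assumes \<Phi>: "entrywise_map d \<Phi> s" and \<Psi>: "entrywise_map m \<Psi> t"
  shows "entrywise_map (d * m) (tensor_map d \<Phi> m \<Psi>)
    (\<lambda>i j. s (i div m) (j div m) * t (i mod m) (j mod m))"
  unfolding entrywise_map_def
proof (intro allI impI conjI)
  fix a b i j assume ab: "a < d * m" "b < d * m" and ij: "i < d * m" "j < d * m"
  note lt = index_div_mod_less[OF ij(1)] index_div_mod_less[OF ij(2)]
  have \<Phi>_entry: "\<Phi> (matrix_unit d a b) $$ (i, j) = (if i = a \<and> j = b then s a b else 0)"
    if "a < d" "b < d" "i < d" "j < d" for a b i j
    using \<Phi> that unfolding entrywise_map_def by blast
  have \<Psi>_entry: "\<Psi> (matrix_unit m a b) $$ (i, j) = (if i = a \<and> j = b then t a b else 0)"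
    if "a < m" "b < m" "i < m" "j < m" for a b i j
    using \<Psi> that unfolding entrywise_map_def by blast
  let ?X = "matrix_unit (d * m) a b"
  define g where "g = (\<lambda>(a', b', c, e). ?X $$ (a' * m + c, b' * m + e) *
      (\<Phi> (matrix_unit d a' b') $$ (i div m, j div m) * \<Psi> (matrix_unit m c e) $$ (i mod m, j mod m)))"
  have "tensor_map d \<Phi> m \<Psi> ?X $$ (i, j) = sum g ({..<d} \<times> {..<d} \<times> {..<m} \<times> {..<m})"
    unfolding g_def using \<Phi> \<Psi> ij by (intro tensor_map_entry) (auto simp: entrywise_map_def)
  \<comment> \<open>Each component map leaves its unit at the same position, so only the units at
    the digits of \<open>i\<close> and \<open>j\<close> contribute.\<close>
  also have "\<dots> = g (i div m, j div m, i mod m, j mod m)"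
    using lt by (intro sum_single) (auto simp: g_def \<Phi>_entry \<Psi>_entry split: if_splits)
  also have "\<dots> = (if i = a \<and> j = b then s (a div m) (b div m) * t (a mod m) (b mod m) else 0)"
    using lt ij by (auto simp: g_def \<Phi>_entry \<Psi>_entry matrix_unit_entry)
  finally show "tensor_map d \<Phi> m \<Psi> ?X $$ (i, j)
    = (if i = a \<and> j = b then s (a div m) (b div m) * t (a mod m) (b mod m) else 0)" .
qed simp

text \<open>The Kronecker power of \<open>s\<close>. The first tensor factor is the leading digit to
  base \<open>d\<close>, as in \<open>tensor_power_map\<close>.\<close>

primrec schur_power :: "nat \<Rightarrow> (nat \<Rightarrow> nat \<Rightarrow> complex) \<Rightarrow> nat \<Rightarrow> nat \<Rightarrow> nat \<Rightarrow> complex" where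
  "schur_power d s 0 = (\<lambda>i j. 1)"
| "schur_power d s (Suc n) =
    (\<lambda>i j. s (i div d ^ n) (j div d ^ n) * schur_power d s n (i mod d ^ n) (j mod d ^ n))"

lemma entrywise_map_tensor_power:
  assumes "entrywise_map d \<Phi> s"
  shows "entrywise_map (d ^ n) (tensor_power_map d \<Phi> n) (schur_power d s n)"
proof (induction n)
  case 0
  show ?case by (auto simp: entrywise_map_def matrix_unit_def)
next
  case (Suc n)
  show ?case using entrywise_map_tensor[OF assms Suc] by simp
qed

lemma schur_power_diag:
  assumes "\<And>i. i < d \<Longrightarrow> s i i = 1"
  shows "i < d ^ n \<Longrightarrow> schur_power d s n i i = 1"
proof (induction n arbitrary: i)
  case (Suc n)
  then have "i div d ^ n < d" "i mod d ^ n < d ^ n"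
    using index_div_mod_less[of i d "d ^ n"] by auto
  then show ?case using assms Suc.IH by simp
qed simp

lemma schur_power_herm:
  assumes "herm d s"
  shows "herm (d ^ n) (schur_power d s n)"
proof (induction n)
  case (Suc n)
  show ?case
    unfolding herm_def
  proof (intro allI impI)
    fix i j assume "i < d ^ Suc n" "j < d ^ Suc n"
    then have lt: "i div d ^ n < d" "i mod d ^ n < d ^ n" "j div d ^ n < d" "j mod d ^ n < d ^ n"
      using index_div_mod_less[of i d "d ^ n"] index_div_mod_less[of j d "d ^ n"] by auto
    have "s (j div d ^ n) (i div d ^ n) = cnj (s (i div d ^ n) (j div d ^ n))"
      "schur_power d s n (j mod d ^ n) (i mod d ^ n) = cnj (schur_power d s n (i mod d ^ n) (j mod d ^ n))"
      using assms Suc.IH lt unfolding herm_def by blast+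
    then show "schur_power d s (Suc n) j i = cnj (schur_power d s (Suc n) i j)"
      by (simp only: schur_power.simps complex_cnj_mult)
  qed
qed (simp add: herm_def)

section \<open>The maximally entangled state and the Choi matrix\<close>

definition max_entangled :: "nat \<Rightarrow> nat \<Rightarrow> complex" where
  "max_entangled n p = (if p div n = p mod n then of_real (1 / sqrt (real n)) else 0)"

lemma max_entangled_norm:
  assumes "0 < n"
  shows "ip (n * n) (max_entangled n) (max_entangled n) = 1"
proof -
  have sq: "complex_of_real (1 / sqrt (real n)) * cnj (of_real (1 / sqrt (real n))) = of_real (1 / real n)"
    by (simp only: complex_cnj_complex_of_real of_real_mult[symmetric]) simp
  have "ip (n * n) (max_entangled n) (max_entangled n)
      = (\<Sum>p<n * n. if p div n = p mod n then of_real (1 / real n) else 0)"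
    unfolding ip_def max_entangled_def sq[symmetric] by (intro sum.cong refl) auto
  also have "\<dots> = 1" unfolding sum_diagonal_index using assms by simp
  finally show ?thesis .
qed

text \<open>The input is the sum of \<open>E \<otimes> E\<close> over all matrix units
  \<open>E\<close>, divided by \<open>n\<close>, so the output is the Choi matrix of
  \<open>\<Theta>\<close> up to that factor: the second digits of \<open>i\<close> and
  \<open>j\<close> select the unit, the first digits the entry of its image.\<close>

lemma choi_entry:
  assumes \<Theta>: "\<And>a b. a < n \<Longrightarrow> b < n \<Longrightarrow> \<Theta> (matrix_unit n a b) \<in> carrier_mat n n"
    and ij: "i < n * n" "j < n * n"
  shows "tensor_map n \<Theta> n (\<lambda>Y. Y)
      (mat (n * n) (n * n) (\<lambda>(p, q). max_entangled n p * cnj (max_entangled n q))) $$ (i, j)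
    = \<Theta> (matrix_unit n (i mod n) (j mod n)) $$ (i div n, j div n) / of_nat n"
proof -
  note lt = index_div_mod_less[OF ij(1)] index_div_mod_less[OF ij(2)]
  have lt_sq: "a * n + c < n * n" if "a < n" "c < n" for a c
  proof -
    have "a * n + c < Suc a * n" using that by simp
    also have "\<dots> \<le> n * n" using that by (intro mult_right_mono) auto
    finally show ?thesis .
  qed
  have sq: "complex_of_real (1 / sqrt (real n)) * cnj (of_real (1 / sqrt (real n))) = 1 / of_nat n"
    by (simp only: complex_cnj_complex_of_real of_real_mult[symmetric]) simp
  let ?X = "mat (n * n) (n * n) (\<lambda>(p, q). max_entangled n p * cnj (max_entangled n q))"
  define g where "g = (\<lambda>(a, b, c, e). ?X $$ (a * n + c, b * n + e) *
      (\<Theta> (matrix_unit n a b) $$ (i div n, j div n) * matrix_unit n c e $$ (i mod n, j mod n)))"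
  have "tensor_map n \<Theta> n (\<lambda>Y. Y) ?X $$ (i, j) = sum g ({..<n} \<times> {..<n} \<times> {..<n} \<times> {..<n})"
    unfolding g_def using \<Theta> ij by (intro tensor_map_entry) auto
  also have "\<dots> = g (i mod n, j mod n, i mod n, j mod n)"
    using lt by (intro sum_single) (auto simp: g_def matrix_unit_entry lt_sq max_entangled_def split: if_splits)
  also have "\<dots> = (1 / of_nat n) * \<Theta> (matrix_unit n (i mod n) (j mod n)) $$ (i div n, j div n)"
    unfolding sq[symmetric] using lt by (simp add: g_def matrix_unit_entry lt_sq max_entangled_def)
  finally show ?thesis by simp
qed

section \<open>The lower bound for a mixture of unitary channels\<close>

lemma diamond_norm_ge:
  assumes "1 \<le> m" "X \<in> carrier_mat (d * m) (d * m)" "trace_norm X \<le> 1"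
  shows "ereal (trace_norm (tensor_map d \<Theta> m (\<lambda>Y. Y) X)) \<le> diamond_norm d \<Theta>"
  unfolding diamond_norm_def map_norm1_def
  using assms by (intro SUP_upper2[of m] SUP_upper) auto

lemma unitary_mixture_unit:
  assumes U: "\<And>k. k < r \<Longrightarrow> U k \<in> unitaries n" and "a < n" "b < n" "i < n" "j < n"
  shows "mat_sum n (\<lambda>k. complex_of_real (p k) \<cdot>\<^sub>m (U k * matrix_unit n a b * mat_adjoint (U k))) {..<r} $$ (i, j)
    = (\<Sum>k<r. of_real (p k) * (U k $$ (i, a) * cnj (U k $$ (j, b))))"
proof -
  have "(complex_of_real (p k) \<cdot>\<^sub>m (U k * matrix_unit n a b * mat_adjoint (U k))) $$ (i, j)
      = of_real (p k) * (U k $$ (i, a) * cnj (U k $$ (j, b)))" if "k < r" for k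
  proof -
    have c: "U k \<in> carrier_mat n n" using U[OF that] by (simp add: unitaries_def)
    have "dim_row (U k) = n" "dim_col (mat_adjoint (U k)) = n"
      using c mat_adjoint_carrier[OF c] by auto
    then show ?thesis using conjugated_matrix_unit_entry[OF c assms(2-5)] assms(4,5) by simp
  qed
  then show ?thesis using assms by (simp add: mat_sum_def)
qed

lemma diamond_dist_schur_power_ge:
  assumes d: "1 \<le> d" and \<Phi>: "entrywise_map d \<Phi> s" and diag: "\<And>i. i < d \<Longrightarrow> s i i = 1"
    and h: "herm d s" and e: "eigenbasis d s V D"
    and c: "\<And>w. w \<in> spectral_support d V D \<Longrightarrow> c \<le> (\<Sum>i<d. (cmod (w i) - 1)\<^sup>2)"
    and "1 \<le> n"
    and \<Psi>: "\<Psi> \<in> conv_maps (d ^ n) (unitary_channels (d ^ n))"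
  shows "ereal (c / real d) \<le> diamond_dist (d ^ n) (tensor_power_map d \<Phi> n) \<Psi>"
proof -
  have V: "orthonormal d d V" using e by (simp add: eigenbasis_def)
  \<comment> \<open>Split off the first tensor factor, on which the projection will act; the other
    factors together have dimension \<open>m\<close>.\<close>
  obtain n' where n': "n = Suc n'" using \<open>1 \<le> n\<close> by (cases n) auto
  define m where "m = d ^ n'"
  define N where "N = d * m"
  have N: "d ^ n = N" by (simp add: n' m_def N_def)
  have pos: "0 < m" "0 < N" using d by (simp_all add: m_def N_def)
  define t where "t = schur_power d s n"
  have tensor: "entrywise_map N (tensor_power_map d \<Phi> n) t"
    unfolding t_def N[symmetric] by (rule entrywise_map_tensor_power[OF \<Phi>])
  have t_herm: "herm N t"
    unfolding t_def N[symmetric] by (rule schur_power_herm[OF h])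
  \<comment> \<open>Equal digits \<open>r\<close> in the remaining factors meet the diagonal of the
    remaining power, where it is \<open>1\<close>, so only \<open>s\<close> is left.\<close>
  have t_slice: "t (i * m + r) (j * m + r) = s i j" if "r < m" for i j r
    using that schur_power_diag[of d s r n', OF diag] by (simp add: t_def n' flip: m_def)
  obtain r p \<Psi>' where \<Psi>': "\<Psi> = (\<lambda>X. mat_sum N (\<lambda>k. complex_of_real (p k) \<cdot>\<^sub>m \<Psi>' k X) {..<r})"
    "\<And>k. k < (r :: nat) \<Longrightarrow> 0 \<le> p k \<and> \<Psi>' k \<in> unitary_channels N" "(\<Sum>k<r. p k) = 1"
    using \<Psi> unfolding N conv_maps_def by blast
  then have "\<forall>k<r. \<exists>U. U \<in> unitaries N \<and> \<Psi>' k = (\<lambda>X. U * X * mat_adjoint U)"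
    unfolding unitary_channels_def by blast
  then obtain U where U: "\<And>k. k < r \<Longrightarrow> U k \<in> unitaries N"
    "\<And>k. k < r \<Longrightarrow> \<Psi>' k = (\<lambda>X. U k * X * mat_adjoint (U k))"
    by metis
  have \<Psi>_eq: "\<Psi> X = mat_sum N (\<lambda>k. complex_of_real (p k) \<cdot>\<^sub>m (U k * X * mat_adjoint (U k))) {..<r}" for X
    unfolding \<Psi>'(1) mat_sum_def using U(2) by simp
  define \<Theta> where "\<Theta> X = tensor_power_map d \<Phi> n X - \<Psi> X" for X
  have \<Psi>_carrier: "\<Psi> X \<in> carrier_mat N N" for X by (simp add: \<Psi>_eq)
  then have \<Theta>_carrier: "\<Theta> X \<in> carrier_mat N N" for X by (simp add: \<Theta>_def minus_carrier_mat)
  have \<Theta>_entry: "\<Theta> (matrix_unit N a b) $$ (i, j) = (if i = a \<and> j = b then t a b else 0)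
      - (\<Sum>k<r. of_real (p k) * (U k $$ (i, a) * cnj (U k $$ (j, b))))"
    if "a < N" "b < N" "i < N" "j < N" for a b i j
  proof -
    have "\<Psi> (matrix_unit N a b) $$ (i, j) = (\<Sum>k<r. of_real (p k) * (U k $$ (i, a) * cnj (U k $$ (j, b))))"
      unfolding \<Psi>_eq using U(1) that by (rule unitary_mixture_unit)
    moreover have "tensor_power_map d \<Phi> n (matrix_unit N a b) $$ (i, j) = (if i = a \<and> j = b then t a b else 0)"
      using tensor that unfolding entrywise_map_def by blast
    ultimately show ?thesis using \<Psi>_carrier[of "matrix_unit N a b"] that by (simp add: \<Theta>_def)
  qed
  define X where "X = mat (N * N) (N * N) (\<lambda>(p, q). max_entangled N p * cnj (max_entangled N q))"
  define A where "A = tensor_map N \<Theta> N (\<lambda>Y. Y) X"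
  have A_carrier: "A \<in> carrier_mat (N * N) (N * N)" by (simp add: A_def)
  have A_entry: "A $$ (i, j) = \<Theta> (matrix_unit N (i mod N) (j mod N)) $$ (i div N, j div N) / of_nat N"
    if "i < N * N" "j < N * N" for i j
    unfolding A_def X_def using \<Theta>_carrier that by (rule choi_entry)
  have A_herm: "herm (N * N) (entries A)"
    unfolding herm_def
  proof (intro allI impI)
    fix i j assume ij: "i < N * N" "j < N * N"
    note lt = index_div_mod_less[OF ij(1)] index_div_mod_less[OF ij(2)]
    have "t (j mod N) (i mod N) = cnj (t (i mod N) (j mod N))" using t_herm lt unfolding herm_def by blast
    then show "A $$ (j, i) = cnj (A $$ (i, j))"
      unfolding A_entry[OF ij] A_entry[OF ij(2,1)] using lt by (simp add: \<Theta>_entry mult.commute)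
  qed
  define R where "R = support_proj d V D"
  \<comment> \<open>The test operator. The index \<open>(i * m + r) * N + (i * m + r)\<close> in
    what follows belongs to the tensor product of the basis vector \<open>i * m + r\<close> with
    itself.\<close>
  define Q where "Q = diagonal_embedding N (tensor_identity m R)"
  have pairing_Q: "pairing (N * N) a Q
      = (\<Sum>r<m. pairing d (\<lambda>i j. a ((i * m + r) * N + (i * m + r)) ((j * m + r) * N + (j * m + r))) R)" for a
    unfolding Q_def pairing_diagonal_embedding by (subst (1) N_def) (rule pairing_tensor_identity)
  have form_Q: "Re (ip (N * N) (app (N * N) Q v) v)
      = (\<Sum>r<m. Re (ip d (app d R (\<lambda>i. v ((i * m + r) * N + (i * m + r)))) (\<lambda>i. v ((i * m + r) * N + (i * m + r)))))"
    for v
    unfolding pairing_rank_one[symmetric] pairing_Q Re_sum ..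
  \<comment> \<open>The form of \<open>Q\<close> is a sum over slices of forms of the projection,
    and the slices use disjoint sets of coordinates of \<open>v\<close>.\<close>
  have Q: "0 \<le> Re (ip (N * N) (app (N * N) Q v) v)" "Re (ip (N * N) (app (N * N) Q v) v) \<le> Re (ip (N * N) v v)" for v
  proof -
    show "0 \<le> Re (ip (N * N) (app (N * N) Q v) v)"
      unfolding form_Q R_def support_proj_form(1)[OF V] by (intro sum_nonneg ip_self_nonneg)
    have "Re (ip (N * N) (app (N * N) Q v) v)
        \<le> (\<Sum>r<m. Re (ip d (\<lambda>i. v ((i * m + r) * N + (i * m + r))) (\<lambda>i. v ((i * m + r) * N + (i * m + r)))))"
      unfolding form_Q R_def by (intro sum_mono support_proj_form(2)[OF V])
    also have "\<dots> = (\<Sum>r<m. \<Sum>i<d. (cmod (v ((i * m + r) * N + (i * m + r))))\<^sup>2)"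
      by (simp add: ip_self)
    also have "\<dots> = (\<Sum>i<d. \<Sum>r<m. (cmod (v ((i * m + r) * N + (i * m + r))))\<^sup>2)" by (rule sum.swap)
    also have "\<dots> = (\<Sum>i<N. (cmod (v (i * N + i)))\<^sup>2)"
      by (simp only: N_def sum_lessThan_mult[of _ d m])
    also have "\<dots> = (\<Sum>p<N * N. if p div N = p mod N then (cmod (v p))\<^sup>2 else 0)"
      by (rule sum_diagonal_index[symmetric])
    also have "\<dots> \<le> (\<Sum>p<N * N. (cmod (v p))\<^sup>2)" by (intro sum_mono) auto
    finally show "Re (ip (N * N) (app (N * N) Q v) v) \<le> Re (ip (N * N) v v)" by (simp add: ip_self)
  qed
  define u where "u k r = (\<lambda>i. U k $$ (i * m + r, i * m + r))" for k r
  have lt_N: "i * m + r < N" if "i < d" "r < m" for i r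
  proof -
    have "i * m + r < Suc i * m" using that by simp
    also have "\<dots> \<le> d * m" using that by (intro mult_right_mono) auto
    finally show ?thesis by (simp add: N_def)
  qed
  \<comment> \<open>At these places both digits agree, so the Choi entry reads the image of a unit
    at that unit's own position: the channel contributes \<open>s i j\<close>, each unitary only its
    diagonal entries.\<close>
  have A_slice: "A $$ ((i * m + x) * N + (i * m + x), (j * m + x) * N + (j * m + x))
      = (s i j - (\<Sum>k<r. of_real (p k) * (u k x i * cnj (u k x j)))) / of_nat N"
    if "i < d" "j < d" "x < m" for i j x
  proof -
    have lt_sq: "a * N + a < N * N" if "a < N" for a
    proof -
      have "a * N + a < Suc a * N" using that by simp
      also have "\<dots> \<le> N * N" using that by (intro mult_right_mono) auto
      finally show ?thesis .
    qed
    note lt = lt_N[OF that(1,3)] lt_N[OF that(2,3)]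
    have dm: "(a * N + a) div N = a" "(a * N + a) mod N = a" if "a < N" for a
      using that by auto
    show ?thesis
      unfolding A_entry[OF lt_sq[OF lt(1)] lt_sq[OF lt(2)]] dm[OF lt(1)] dm[OF lt(2)] \<Theta>_entry[OF lt lt]
      using t_slice[OF that(3)] by (simp add: u_def)
  qed
  \<comment> \<open>The channel contributes the trace of \<open>s\<close>, which is
    \<open>d\<close>; each unitary contributes the form of the projection at its slice
    \<open>u k x\<close>.\<close>
  have slice: "pairing d (\<lambda>i j. A $$ ((i * m + x) * N + (i * m + x), (j * m + x) * N + (j * m + x))) R
      = (of_nat d - (\<Sum>k<r. of_real (p k) * ip d (app d R (u k x)) (u k x))) / of_nat N" if "x < m" for x
  proof -
    have "pairing d (\<lambda>i j. A $$ ((i * m + x) * N + (i * m + x), (j * m + x) * N + (j * m + x))) R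
        = (\<Sum>i<d. \<Sum>j<d. (s i j * R j i - (\<Sum>k<r. of_real (p k) * (u k x i * cnj (u k x j) * R j i))) / of_nat N)"
      unfolding pairing_def using A_slice[OF _ _ that]
      by (intro sum.cong refl) (simp add: right_diff_distrib sum_distrib_left mult_ac)
    also have "\<dots> = (pairing d s R - (\<Sum>i<d. \<Sum>j<d. \<Sum>k<r. of_real (p k) * (u k x i * cnj (u k x j) * R j i))) / of_nat N"
      by (simp add: pairing_def sum_subtractf flip: sum_divide_distrib)
    also have "(\<Sum>i<d. \<Sum>j<d. \<Sum>k<r. of_real (p k) * (u k x i * cnj (u k x j) * R j i))
        = (\<Sum>i<d. \<Sum>k<r. \<Sum>j<d. of_real (p k) * (u k x i * cnj (u k x j) * R j i))"
      by (rule sum.cong[OF refl], rule sum.swap)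
    also have "\<dots> = (\<Sum>k<r. \<Sum>i<d. \<Sum>j<d. of_real (p k) * (u k x i * cnj (u k x j) * R j i))" by (rule sum.swap)
    also have "\<dots> = (\<Sum>k<r. of_real (p k) * ip d (app d R (u k x)) (u k x))"
      by (simp add: pairing_def sum_distrib_left flip: pairing_rank_one)
    also have "pairing d s R = of_nat d"
      using pairing_support_proj[OF e] diag by (simp add: pairing_def R_def)
    finally show ?thesis .
  qed
  \<comment> \<open>By \<open>support_proj_form_le\<close> each unitary reaches at most
    \<open>real d - c\<close>, and averaging with the weights \<open>p\<close> keeps this bound.
    Each of the \<open>m\<close> slices thus gives at least \<open>c / real N\<close>, in total
    \<open>c / real d\<close>.\<close>
  have "c / real N \<le> Re (pairing d (\<lambda>i j. A $$ ((i * m + x) * N + (i * m + x), (j * m + x) * N + (j * m + x))) R)"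
    if "x < m" for x
  proof -
    have "p k * Re (ip d (app d R (u k x)) (u k x)) \<le> p k * (real d - c)" if k: "k < r" for k
    proof (intro mult_left_mono)
      show "Re (ip d (app d R (u k x)) (u k x)) \<le> real d - c"
        unfolding R_def using V _ c
      proof (rule support_proj_form_le)
        show "cmod (u k x i) \<le> 1" if "i < d" for i
          unfolding u_def using unitary_diag_le_1[OF U(1)[OF k]] lt_N[OF that \<open>x < m\<close>] by blast
      qed
    qed (use \<Psi>'(2)[OF k] in simp)
    then have "(\<Sum>k<r. p k * Re (ip d (app d R (u k x)) (u k x))) \<le> (\<Sum>k<r. p k * (real d - c))"
      by (intro sum_mono) auto
    also have "\<dots> = real d - c" using \<Psi>'(3) by (simp flip: sum_distrib_right)
    finally have "c / real N \<le> (real d - (\<Sum>k<r. p k * Re (ip d (app d R (u k x)) (u k x)))) / real N"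
      by (intro divide_right_mono) auto
    then show ?thesis unfolding slice[OF that] by (simp add: Re_divide_of_nat)
  qed
  then have "(\<Sum>x<m. c / real N) \<le> Re (pairing (N * N) (entries A) Q)"
    unfolding pairing_Q Re_sum by (intro sum_mono) auto
  also have "\<dots> \<le> trace_norm A"
    unfolding pairing_def using A_carrier A_herm Q by (rule trace_norm_ge_pairing)
  also have "(\<Sum>x<m. c / real N) = c / real d" using pos by (simp add: N_def)
  finally have "ereal (c / real d) \<le> ereal (trace_norm A)" by simp
  also have "\<dots> \<le> diamond_norm N \<Theta>"
    unfolding A_def using pos trace_norm_rank_one[OF max_entangled_norm[OF pos(2)]]
    by (intro diamond_norm_ge) (auto simp: X_def)
  finally show ?thesis unfolding diamond_dist_def N \<Theta>_def[abs_def] .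
qed

theorem corollary1:
  fixes d :: nat and \<Phi> :: "complex mat \<Rightarrow> complex mat"
  assumes "1 \<le> d"
    and "schur_channel d \<Phi>"
    and "kraus_space d \<Phi> \<inter> unitaries d = {}"
  shows "(\<exists>L\<in>kraus_space d \<Phi>. unitarity_defect d L = C_const d \<Phi>) \<and>
    0 < C_const d \<Phi> \<and>
    (\<forall>n\<ge>1. ereal (C_const d \<Phi>) \<le>
       diamond_dist_set (d ^ n) (tensor_power_map d \<Phi> n)
         (conv_maps (d ^ n) (unitary_channels (d ^ n))))"
proof -
  obtain S where S: "psd d S" "\<And>i. i < d \<Longrightarrow> S $$ (i, i) = 1"
    and \<Phi>: "\<And>X. X \<in> carrier_mat d d \<Longrightarrow> \<Phi> X = schur_product S X"
    using assms(2) unfolding schur_channel_def by blast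
  obtain V D where e: "eigenbasis d (entries S) V D" using ex_eigenbasis psd_herm[OF S(1)] by blast
  have K: "kraus_space d \<Phi> = mat_diag d ` spectral_support d V D"
    by (rule kraus_space_schur[OF S(1) \<Phi> e])
  define f where "f w = (\<Sum>i<d. (cmod (w i) - 1)\<^sup>2)" for w :: "nat \<Rightarrow> complex"
  obtain l where l: "l \<in> spectral_support d V D" "\<And>w. w \<in> spectral_support d V D \<Longrightarrow> f l \<le> f w"
    using ex_min_unit_modulus_distance[of d V D] unfolding f_def by blast
  have lK: "mat_diag d l \<in> kraus_space d \<Phi>" using K l(1) by blast
  have defect: "unitarity_defect d (mat_diag d w) = f w / real d" for w
    by (simp add: unitarity_defect_mat_diag f_def)
  have C: "C_const d \<Phi> = f l / real d"
    unfolding C_const_def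
  proof (rule cInf_eq_minimum)
    show "f l / real d \<in> unitarity_defect d ` kraus_space d \<Phi>"
      using lK defect[of l] by (metis imageI)
    show "f l / real d \<le> x" if "x \<in> unitarity_defect d ` kraus_space d \<Phi>" for x
      using that l(2) unfolding K by (auto simp: defect intro!: divide_right_mono)
  qed
  \<comment> \<open>If the minimum were \<open>0\<close>, all entries of \<open>l\<close> would have
    modulus 1 and \<open>mat_diag d l\<close> would be a unitary in the Kraus space.\<close>
  have "f l \<noteq> 0"
  proof
    assume "f l = 0"
    then have "cmod (l i) = 1" if "i < d" for i
      using that unfolding f_def by (subst (asm) sum_nonneg_eq_0_iff) auto
    then show False using mat_diag_unitary lK assms(3) by blast
  qed
  then have "0 < f l" by (simp add: f_def sum_nonneg less_le)
  then have pos: "0 < C_const d \<Phi>" using assms(1) by (simp add: C)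
  have "entrywise_map d \<Phi> (entries S)"
    using \<Phi> by (simp add: entrywise_map_def schur_product_matrix_unit)
      (simp add: schur_product_def matrix_unit_def)
  then have "ereal (C_const d \<Phi>) \<le> diamond_dist (d ^ n) (tensor_power_map d \<Phi> n) \<Psi>"
    if "1 \<le> n" "\<Psi> \<in> conv_maps (d ^ n) (unitary_channels (d ^ n))" for n \<Psi>
    unfolding C using assms(1) S(2) psd_herm[OF S(1)] e l(2) that unfolding f_def
    by (intro diamond_dist_schur_power_ge)
  then show ?thesis
    using pos lK defect[of l] C by (auto simp: diamond_dist_set_def intro!: INF_greatest)
qed

end
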